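(* Let $r\ge 1$, $s\ge 2$, and let $P_1(\underline{x}),\ldots,P_s(\underline{x})\in\mathbb{Z}[\underline{x}]$, $\underline{x}=(x_1,\ldots,x_r)$, be nonzero coprime polynomials. For $\underline{n}\in\mathbb{Z}^r$ put $d_{\underline{n}}=\gcd(P_1(\underline{n}),\ldots,P_s(\underline{n}))$. Then the set $\mathcal{D}=\{d_{\underline{n}}\mid \underline{n}\in\mathbb{Z}^r\}$ is stable under gcd and lcm, i.e., if $d,d'\in\mathcal{D}$ then $\gcd(d,d')\in\mathcal{D}$ and $\operatorname{lcm}(d,d')\in\mathcal{D}$.
   Context: Polynomials $P_1,\ldots,P_s\in\mathbb{Z}[\underline{x}]$ are called coprime if they are coprime over $\mathbb{Q}$: no polynomial $D\in\mathbb{Q}[\underline{x}]$ with $\deg D>0$ divides all of $P_1,\ldots,P_s$ in $\mathbb{Q}[\underline{x}]$. The gcd of integers is the nonnegative one, with the convention $\gcd(0,\ldots,0)=0$ (so $d_{\underline{n}}=0$ when all $P_i(\underline{n})=0$). *)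

theory Defs
  imports Complex_Main "HOL-Library.Poly_Mapping" "HOL-Library.FuncSet"
begin

text \<open>
  Exponent vectors are finitely supported maps from variable indices to exponents, and a
  polynomial is a finitely supported map from exponent vectors to coefficients, with the
  convolution product of \<open>Poly_Mapping\<close>.  The variables \<open>x\<^sub>1, \<dots>, x\<^sub>r\<close> get the indices
  \<open>0, \<dots>, r - 1\<close>.
\<close>

type_synonym 'a mpoly = "(nat \<Rightarrow>\<^sub>0 nat) \<Rightarrow>\<^sub>0 'a"

text \<open>The ring \<open>R[x\<^sub>1, \<dots>, x\<^sub>r]\<close> for \<open>R = UNIV :: 'a set\<close>.\<close>

definition mpolys :: "nat \<Rightarrow> 'a::zero mpoly set" where
  "mpolys r = {p. \<forall>m \<in> Poly_Mapping.keys p. Poly_Mapping.keys m \<subseteq> {..<r}}"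

definition mpoly_eval :: "'a::comm_semiring_1 mpoly \<Rightarrow> (nat \<Rightarrow> 'a) \<Rightarrow> 'a" where
  "mpoly_eval p n =
     (\<Sum>m \<in> Poly_Mapping.keys p. Poly_Mapping.lookup p m *
        (\<Prod>i \<in> Poly_Mapping.keys m. n i ^ Poly_Mapping.lookup m i))"

text \<open>Total degree; the zero polynomial gets degree \<open>0\<close>.\<close>

definition mpoly_degree :: "'a::zero mpoly \<Rightarrow> nat" where
  "mpoly_degree p =
     Max (insert 0 ((\<lambda>m. \<Sum>i \<in> Poly_Mapping.keys m. Poly_Mapping.lookup m i) ` Poly_Mapping.keys p))"

definition rat_mpoly :: "int mpoly \<Rightarrow> rat mpoly" where
  "rat_mpoly p = Poly_Mapping.map of_int p"

text \<open>Both the divisor and the cofactors range over \<open>\<rat>[x\<^sub>1, \<dots>, x\<^sub>r]\<close>.\<close>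

definition coprime_mpolys :: "nat \<Rightarrow> nat \<Rightarrow> (nat \<Rightarrow> int mpoly) \<Rightarrow> bool" where
  "coprime_mpolys r s P \<longleftrightarrow>
     \<not> (\<exists>D \<in> mpolys r. mpoly_degree D > 0 \<and>
          (\<forall>i<s. \<exists>Q \<in> mpolys r. rat_mpoly (P i) = D * Q))"

text \<open>On \<open>int\<close>, \<open>Gcd\<close> is the nonnegative gcd and \<open>Gcd {0} = 0\<close>.\<close>

definition gcd_value :: "nat \<Rightarrow> (nat \<Rightarrow> int mpoly) \<Rightarrow> (nat \<Rightarrow> int) \<Rightarrow> int" where
  "gcd_value s P n = Gcd ((\<lambda>i. mpoly_eval (P i) n) ` {..<s})"

text \<open>\<open>\<int>\<^sup>r\<close> is represented by the extensional functions on \<open>{..<r}\<close>.\<close>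

definition gcd_values :: "nat \<Rightarrow> nat \<Rightarrow> (nat \<Rightarrow> int mpoly) \<Rightarrow> int set" where
  "gcd_values r s P = {gcd_value s P n | n. n \<in> {..<r} \<rightarrow>\<^sub>E UNIV}"

end

theory Submission
  imports Defs "HOL-Number_Theory.Cong" "HOL-Computational_Algebra.Polynomial"
begin

text \<open>
  It suffices to find, for nonzero values \<open>d = d\<^sub>n\<close> and \<open>d' = d\<^sub>n'\<close> and any choice between
  \<open>d\<close> and \<open>d'\<close> at each prime, a point \<open>m\<close> whose value \<open>d\<^sub>m\<close> has the chosen multiplicity at
  every prime.  At the primes dividing a suitable modulus this is achieved by prescribing \<open>m\<close>
  modulo high prime powers to agree with \<open>n\<close> or \<open>n'\<close>.  That \<open>m\<close> can moreover be taken such that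
  \<open>d\<^sub>m\<close> has no other prime divisors is shown by induction on the number of variables; the
  algebraic input is that coprime polynomials over a factorial domain \<open>S\<close> generate an ideal of
  \<open>S[y]\<close> that contains a nonzero constant.
\<close>

section \<open>Factorial subrings and their polynomial rings\<close>

text \<open>The induction varies the number of variables, so the rings \<open>mpolys r\<close> are
  subsets of one type, and divisibility, primality and factoriality are all relative to such a
  subset.

  Some primes cannot be avoided by any choice of the point. Coprimality over the rationals allows an
  integer to divide all the polynomials, and a prime can divide all values without dividing all
  coefficients: both \<open>y (y + 1)\<close> and \<open>y (y + 1) + 2\<close> take only even
  values. Such primes are absorbed into a bound \<open>B\<close>, and the sieving statement is made
  for every multiple \<open>N\<close> of \<open>B\<close> and every prescribed residue modulo
  \<open>N\<close>. Hence \<open>N\<close> can later be raised to the precision that fixes the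
  multiplicities at its primes.

  The constant obtained by elimination is constant only in the last variable. It is a polynomial in
  the other ones and bounds the primes to be avoided only at points where it does not
  vanish.\<close>

definition dvd_in :: "'a::idom set \<Rightarrow> 'a \<Rightarrow> 'a \<Rightarrow> bool" where
  "dvd_in S a b \<longleftrightarrow> (\<exists>c\<in>S. b = a * c)"

definition prime_in :: "'a::idom set \<Rightarrow> 'a \<Rightarrow> bool" where
  "prime_in S p \<longleftrightarrow> p \<in> S \<and> p \<noteq> 0 \<and> \<not> dvd_in S p 1 \<and>
     (\<forall>a\<in>S. \<forall>b\<in>S. dvd_in S p (a * b) \<longrightarrow> dvd_in S p a \<or> dvd_in S p b)"

lemma dvd_inI: "c \<in> S \<Longrightarrow> b = a * c \<Longrightarrow> dvd_in S a b"
  by (auto simp: dvd_in_def)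

lemma dvd_inE:
  assumes "dvd_in S a b"
  obtains c where "c \<in> S" "b = a * c"
  using assms by (auto simp: dvd_in_def)

text \<open>The index counts the prime factors; it is the measure that decreases when primes are
  stripped off in \<open>primitive_part_exists\<close>.\<close>

inductive prime_product :: "'a::idom set \<Rightarrow> nat \<Rightarrow> 'a \<Rightarrow> bool" for S where
  unit: "u \<in> S \<Longrightarrow> dvd_in S u 1 \<Longrightarrow> prime_product S 0 u"
| prime: "prime_in S p \<Longrightarrow> prime_product S n a \<Longrightarrow> prime_product S (Suc n) (p * a)"

text \<open>Existence suffices as an axiom: the factors are prime, not merely irreducible, and this
  makes factorizations unique up to order and units.\<close>

locale ufd_subring =
  fixes S :: "'a::idom set"
  assumes one_closed: "1 \<in> S"
    and diff_closed: "a \<in> S \<Longrightarrow> b \<in> S \<Longrightarrow> a - b \<in> S"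
    and mult_closed: "a \<in> S \<Longrightarrow> b \<in> S \<Longrightarrow> a * b \<in> S"
    and factorization: "a \<in> S \<Longrightarrow> a \<noteq> 0 \<Longrightarrow> \<exists>n. prime_product S n a"

definition polys_over :: "'a::zero set \<Rightarrow> 'a poly set" where
  "polys_over S = {p. \<forall>n. coeff p n \<in> S}"

lemma smult_cancel_left:
  fixes a :: "'a::idom"
  assumes "a \<noteq> 0" "smult a p = smult a q"
  shows "p = q"
  using assms smult_diff_right[of a p q] by simp

context ufd_subring
begin

lemma zero_closed: "0 \<in> S"
  using diff_closed[OF one_closed one_closed] by simp

lemma uminus_closed: "a \<in> S \<Longrightarrow> - a \<in> S"
  using diff_closed[OF zero_closed, of a] by simp

lemma add_closed: "a \<in> S \<Longrightarrow> b \<in> S \<Longrightarrow> a + b \<in> S"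
  using diff_closed[of a "- b"] uminus_closed[of b] by simp

lemma sum_closed: "(\<And>i. i \<in> A \<Longrightarrow> f i \<in> S) \<Longrightarrow> sum f A \<in> S"
  by (induction A rule: infinite_finite_induct) (auto intro: add_closed zero_closed)

lemma dvd_in_mult_right: "dvd_in S a b \<Longrightarrow> c \<in> S \<Longrightarrow> dvd_in S a (b * c)"
  unfolding dvd_in_def using mult_closed mult.assoc by blast

lemma dvd_in_mult_left: "dvd_in S a b \<Longrightarrow> c \<in> S \<Longrightarrow> dvd_in S a (c * b)"
  using dvd_in_mult_right by (simp add: mult.commute)

lemma dvd_in_trans: "dvd_in S a b \<Longrightarrow> dvd_in S b c \<Longrightarrow> dvd_in S a c"
  unfolding dvd_in_def using mult_closed by (auto simp: mult.assoc)

lemma dvd_in_add: "dvd_in S a b \<Longrightarrow> dvd_in S a c \<Longrightarrow> dvd_in S a (b + c)"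
  by (elim dvd_inE, rule dvd_inI[of "_ + _"]) (auto intro: add_closed simp: distrib_left)

lemma dvd_in_diff: "dvd_in S a b \<Longrightarrow> dvd_in S a c \<Longrightarrow> dvd_in S a (b - c)"
  by (elim dvd_inE, rule dvd_inI[of "_ - _"]) (auto intro: diff_closed simp: right_diff_distrib)

lemma dvd_in_zero: "dvd_in S a 0"
  unfolding dvd_in_def using zero_closed by force

lemma dvd_in_sum: "(\<And>i. i \<in> A \<Longrightarrow> dvd_in S a (f i)) \<Longrightarrow> dvd_in S a (sum f A)"
  by (induction A rule: infinite_finite_induct) (auto intro: dvd_in_add dvd_in_zero)

lemma dvd_in_self: "dvd_in S a a"
  unfolding dvd_in_def using one_closed by force

lemma unit_mult:
  assumes "u \<in> S" "v \<in> S" "dvd_in S u 1" "dvd_in S v 1"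
  shows "dvd_in S (u * v) 1"
proof -
  obtain x y where "x \<in> S" "1 = u * x" "y \<in> S" "1 = v * y" using assms by (auto simp: dvd_in_def)
  then have "x * y \<in> S" "1 = (u * v) * (x * y)" by (auto intro: mult_closed simp: mult.commute mult.left_commute)
  then show ?thesis by (rule dvd_inI)
qed

lemma prime_product_closed: "prime_product S n a \<Longrightarrow> a \<in> S"
  by (induction rule: prime_product.induct) (auto intro: mult_closed simp: prime_in_def)

lemma prime_product_unit_mult:
  assumes "prime_product S n a" "v \<in> S" "dvd_in S v 1"
  shows "prime_product S n (v * a)"
  using assms(1)
proof induction
  case (unit u)
  then show ?case using assms(2,3) by (intro prime_product.unit mult_closed unit_mult)
next
  case (prime p n a)
  then show ?case using prime_product.prime[of S p n "v * a"] by (simp add: mult.left_commute)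
qed

text \<open>Uniqueness of factorization in the form needed later. The prime \<open>p\<close> divides
  either the rest of the product, where the induction applies, or the head \<open>q\<close>. In the
  latter case \<open>p\<close> and \<open>q\<close> are associates, and their unit quotient is
  absorbed into the rest.\<close>

lemma prime_product_cancel:
  assumes "prime_product S n x" "x = p * b" "prime_in S p" "b \<in> S"
  shows "\<exists>m. n = Suc m \<and> prime_product S m b"
  using assms(1,2,4)
proof (induction arbitrary: b)
  case (unit u)
  then obtain x where x: "x \<in> S" "1 = u * x" by (auto simp: dvd_in_def)
  then have "1 = p * (b * x)" using unit.prems by (metis mult.assoc)
  then have "dvd_in S p 1" using mult_closed[OF unit.prems(2) x(1)] by (rule dvd_inI[rotated])
  then show ?case using assms(3) by (simp add: prime_in_def)
next
  case (prime q n a)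
  have p: "p \<in> S" "p \<noteq> 0" "\<not> dvd_in S p 1" using assms(3) by (auto simp: prime_in_def)
  have q: "q \<in> S" "q \<noteq> 0" "\<not> dvd_in S q 1" using prime.hyps by (auto simp: prime_in_def)
  have aS: "a \<in> S" using prime.hyps(2) by (rule prime_product_closed)
  have "dvd_in S p (q * a)" using prime.prems by (auto simp: dvd_in_def)
  then consider "dvd_in S p a" | "dvd_in S p q"
    using assms(3) q aS by (auto simp: prime_in_def)
  then show ?case
  proof cases
    case 1
    then obtain a' where a': "a' \<in> S" "a = p * a'" by (auto simp: dvd_in_def)
    then obtain m where m: "n = Suc m" "prime_product S m a'" using prime.IH by blast
    have "b = q * a'" using prime.prems(1) a'(2) p(2) by (simp add: mult.left_commute)
    then show ?thesis using m prime.hyps(1) by (auto intro: prime_product.prime)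
  next
    case 2
    then obtain v where v: "v \<in> S" "q = p * v" by (auto simp: dvd_in_def)
    \<comment> \<open>Primality of \<open>q\<close> is applied to \<open>q = p * v\<close> itself:
      if \<open>q\<close> divided \<open>v\<close>, then \<open>p\<close> would be a unit, so
      \<open>q\<close> divides \<open>p\<close> and \<open>v\<close> is a unit.\<close>
    have "dvd_in S q (p * v)" using v dvd_in_self by simp
    then consider "dvd_in S q p" | "dvd_in S q v"
      using prime.hyps(1) p v by (auto simp: prime_in_def)
    then have "dvd_in S v 1"
    proof cases
      case 1
      then obtain w where "w \<in> S" "p = q * w" by (auto simp: dvd_in_def)
      then have "1 = v * w" using v p(2) by (simp add: mult.assoc)
      then show ?thesis using \<open>w \<in> S\<close> by (auto simp: dvd_in_def)
    next
      case 2
      then obtain w where "w \<in> S" "v = q * w" by (auto simp: dvd_in_def)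
      then have "q * 1 = q * (p * w)" using v by (simp add: ac_simps)
      then have "1 = p * w" using q by (metis mult_left_cancel)
      then show ?thesis using p \<open>w \<in> S\<close> by (auto simp: dvd_in_def)
    qed
    moreover have "b = v * a" using prime.prems(1) v(2) p(2) by (simp add: mult.assoc)
    ultimately show ?thesis
      using prime.hyps(2) v(1) prime_product_unit_mult by blast
  qed
qed

lemma prime_divisor_exists_in:
  assumes "a \<in> S" "a \<noteq> 0" "\<not> dvd_in S a 1"
  shows "\<exists>p. prime_in S p \<and> dvd_in S p a"
proof -
  obtain n where "prime_product S n a" using factorization assms by blast
  then show ?thesis
  proof cases
    case (prime p m b)
    then show ?thesis using prime prime_product_closed by (auto simp: dvd_in_def)
  qed (use assms in auto)
qed

section \<open>Gauss's theorem: the polynomial ring over a factorial ring is factorial\<close>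

abbreviation "T \<equiv> polys_over S"

lemma coeff_closed: "p \<in> T \<Longrightarrow> coeff p n \<in> S"
  by (simp add: polys_over_def)

lemma poly_diff_closed: "p \<in> T \<Longrightarrow> q \<in> T \<Longrightarrow> p - q \<in> T"
  by (simp add: polys_over_def diff_closed)

lemma poly_add_closed: "p \<in> T \<Longrightarrow> q \<in> T \<Longrightarrow> p + q \<in> T"
  by (simp add: polys_over_def add_closed)

lemma poly_mult_closed: "p \<in> T \<Longrightarrow> q \<in> T \<Longrightarrow> p * q \<in> T"
  by (auto simp: polys_over_def coeff_mult intro!: sum_closed mult_closed)

lemma poly_smult_closed: "c \<in> S \<Longrightarrow> q \<in> T \<Longrightarrow> smult c q \<in> T"
  by (simp add: polys_over_def mult_closed)

lemma monom_closed: "c \<in> S \<Longrightarrow> monom c n \<in> T"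
  by (simp add: polys_over_def zero_closed)

lemma const_closed: "c \<in> S \<Longrightarrow> [:c:] \<in> T"
  using monom_closed[of c 0] by (simp add: monom_0)

lemma poly_one_closed: "1 \<in> T"
  using const_closed[OF one_closed] by (simp add: one_pCons)

lemma dvd_in_const_iff:
  assumes "c \<in> S" "c \<noteq> 0" "f \<in> T"
  shows "dvd_in T [:c:] f \<longleftrightarrow> (\<forall>n. dvd_in S c (coeff f n))"
proof
  assume *: "\<forall>n. dvd_in S c (coeff f n)"
  \<comment> \<open>The quotient is chosen as a function of the coefficient, not of its index, so
    that \<open>map_poly\<close> applies; \<open>map_poly\<close> needs the value 0 at 0.\<close>
  define q where "q x = (if x = 0 then 0 else SOME d. d \<in> S \<and> x = c * d)" for x
  have q: "q (coeff f n) \<in> S \<and> coeff f n = c * q (coeff f n)" for n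
  proof (cases "coeff f n = 0")
    case False
    have "\<exists>d. d \<in> S \<and> coeff f n = c * d" using * by (auto simp: dvd_in_def)
    from someI_ex[OF this] show ?thesis using False by (simp add: q_def)
  qed (simp add: q_def zero_closed)
  have "map_poly q f \<in> T" using q by (simp add: polys_over_def coeff_map_poly q_def)
  moreover have "f = [:c:] * map_poly q f"
    using q by (intro poly_eqI) (simp add: coeff_map_poly q_def)
  ultimately show "dvd_in T [:c:] f" unfolding dvd_in_def by blast
qed (auto simp: dvd_in_def coeff_closed)

lemma unit_const_iff:
  assumes "c \<in> S" "c \<noteq> 0"
  shows "dvd_in T [:c:] 1 \<longleftrightarrow> dvd_in S c 1"
  using dvd_in_const_iff[OF assms poly_one_closed] by (auto simp: dvd_in_zero)

text \<open>Gauss's lemma. If \<open>p\<close> divides neither factor, let \<open>i\<close> and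
  \<open>j\<close> be the first indices of coefficients not divisible by \<open>p\<close>; in the
  coefficient \<open>i + j\<close> of the product every other term is divisible by
  \<open>p\<close>.\<close>

lemma prime_in_const:
  assumes "prime_in S p"
  shows "prime_in T [:p:]"
proof -
  have p: "p \<in> S" "p \<noteq> 0" "\<not> dvd_in S p 1" using assms by (auto simp: prime_in_def)
  have "dvd_in T [:p:] f \<or> dvd_in T [:p:] g"
    if fg: "f \<in> T" "g \<in> T" "dvd_in T [:p:] (f * g)" for f g
  proof (rule ccontr)
    assume "\<not> ?thesis"
    then have "\<exists>i. \<not> dvd_in S p (coeff f i)" "\<exists>j. \<not> dvd_in S p (coeff g j)"
      using dvd_in_const_iff p fg by auto
    then obtain i j where
      i: "\<not> dvd_in S p (coeff f i)" "\<And>k. k < i \<Longrightarrow> dvd_in S p (coeff f k)" and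
      j: "\<not> dvd_in S p (coeff g j)" "\<And>k. k < j \<Longrightarrow> dvd_in S p (coeff g k)"
      unfolding exists_least_iff[of "\<lambda>i. \<not> dvd_in S p (coeff _ i)"] by blast
    have "dvd_in S p (coeff f k * coeff g (i + j - k))" if "k \<in> {..i + j} - {i}" for k
    proof (cases "k < i")
      case True
      then show ?thesis using i fg by (auto intro: dvd_in_mult_right coeff_closed)
    next
      case False
      then have "i + j - k < j" using that by auto
      then show ?thesis using j fg by (auto intro: dvd_in_mult_left coeff_closed)
    qed
    then have rest: "dvd_in S p (\<Sum>k\<in>{..i + j} - {i}. coeff f k * coeff g (i + j - k))"
      by (rule dvd_in_sum)
    have whole: "dvd_in S p (coeff (f * g) (i + j))"
      using fg(3) p dvd_in_const_iff[of p "f * g"] poly_mult_closed fg by auto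
    have "coeff (f * g) (i + j) - (\<Sum>k\<in>{..i + j} - {i}. coeff f k * coeff g (i + j - k)) =
        coeff f i * coeff g j"
      by (simp add: coeff_mult sum.remove[of _ i])
    with dvd_in_diff[OF whole rest] have "dvd_in S p (coeff f i * coeff g j)"
      by simp
    then show False
      using assms i(1) j(1) coeff_closed[OF fg(1)] coeff_closed[OF fg(2)]
      unfolding prime_in_def by blast
  qed
  then show ?thesis
    using p unit_const_iff[of p] const_closed by (auto simp: prime_in_def)
qed

lemma prime_product_const: "prime_product S n c \<Longrightarrow> prime_product T n [:c:]"
proof (induction rule: prime_product.induct)
  case (unit u)
  then have "u \<noteq> 0" by (auto simp: dvd_in_def)
  then show ?case using unit unit_const_iff const_closed by (auto intro: prime_product.unit)
next
  case (prime p n a)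
  then show ?case using prime_product.prime[OF prime_in_const[OF prime.hyps(1)] prime.IH]
    by (simp add: mult.commute)
qed

text \<open>Over the fraction field the ideal would be principal; here the factor \<open>c\<close>
  clears the denominators. A nonzero element \<open>e\<close> of minimal degree serves, because
  pseudo-division by \<open>e\<close> lowers the degree of \<open>f\<close> within \<open>J\<close>
  until 0 is left.\<close>

lemma ideal_pseudo_generator:
  assumes J: "J \<subseteq> T" "\<And>f g. f \<in> J \<Longrightarrow> g \<in> J \<Longrightarrow> f - g \<in> J" "\<And>f g. f \<in> T \<Longrightarrow> g \<in> J \<Longrightarrow> f * g \<in> J"
    and ne: "\<exists>f\<in>J. f \<noteq> 0"
  shows "\<exists>e\<in>J. e \<noteq> 0 \<and> (\<forall>f\<in>J. \<exists>c\<in>S. c \<noteq> 0 \<and> dvd_in T e (smult c f))"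
proof -
  obtain e where e: "e \<in> J" "e \<noteq> 0" and min: "\<And>f. f \<in> J \<Longrightarrow> f \<noteq> 0 \<Longrightarrow> degree e \<le> degree f"
    using ne ex_has_least_nat[of "\<lambda>f. f \<in> J \<and> f \<noteq> 0" _ degree] by blast
  have eS: "e \<in> T" using e J by auto
  have "\<exists>c\<in>S. c \<noteq> 0 \<and> dvd_in T e (smult c f)" if "f \<in> J" for f
    using that
  proof (induction "degree f" arbitrary: f rule: less_induct)
    case less
    have fS: "f \<in> T" using less J by auto
    show ?case
    proof (cases "f = 0")
      case True
      then have "smult 1 f = e * 0" by simp
      moreover have "0 \<in> T" by (simp add: polys_over_def zero_closed)
      ultimately show ?thesis using one_closed by (metis dvd_inI one_neq_zero)
    next
      case False
      have le: "degree e \<le> degree f" using min less False by blast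
      define m where "m = monom (lead_coeff f) (degree f - degree e)"
      define h where "h = smult (lead_coeff e) f - m * e"
      have lS: "lead_coeff e \<in> S" "m \<in> T"
        using eS fS coeff_closed monom_closed by (auto simp: m_def)
      have "[:lead_coeff e:] * f \<in> J" using J(3) less const_closed lS by blast
      then have hJ: "h \<in> J" using J(2,3) lS e by (simp add: h_def)
      have "degree (m * e) = degree f"
        using False e(2) le by (simp add: m_def degree_mult_eq degree_monom_eq monom_eq_0_iff)
      then have deg: "degree h \<le> degree f"
        unfolding h_def by (intro degree_diff_le) auto
      have "coeff h (degree f) = 0"
        using le by (simp add: h_def m_def coeff_monom_mult)
      \<comment> \<open>For a nonzero constant \<open>f\<close> the degree cannot drop; then
        \<open>h\<close> is 0.\<close>
      then have "h = 0 \<or> degree h < degree f"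
        using deg by (metis leading_coeff_0_iff le_neq_implies_less)
      then have "\<exists>c\<in>S. c \<noteq> 0 \<and> dvd_in T e (smult c h)"
      proof
        assume "h = 0"
        then have "smult 1 h = e * 0" by simp
        moreover have "0 \<in> T" by (simp add: polys_over_def zero_closed)
        ultimately show ?thesis using one_closed by (metis dvd_inI one_neq_zero)
      qed (use less.hyps hJ in blast)
      then obtain c k where c: "c \<in> S" "c \<noteq> 0" "k \<in> T" "smult c h = e * k"
        by (auto simp: dvd_in_def)
      have "smult (c * lead_coeff e) f = smult c h + smult c (m * e)"
        by (simp add: h_def smult_diff_right)
      also have "\<dots> = e * (k + smult c m)"
        by (simp add: c(4) distrib_left mult.commute)
      finally have "dvd_in T e (smult (c * lead_coeff e) f)"
        using c lS by (intro dvd_inI[of "k + smult c m"] poly_add_closed poly_smult_closed)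
      then show ?thesis using c e lS by (intro bexI[of _ "c * lead_coeff e"]) (auto intro: mult_closed)
    qed
  qed
  then show ?thesis using e by blast
qed

text \<open>Each prime factor of \<open>c\<close> stays prime in \<open>T\<close>, so it divides
  \<open>q\<close> or \<open>e\<close> and can be cancelled there; \<open>b\<close> and
  \<open>a\<close> collect what is cancelled from \<open>q\<close> and from
  \<open>e\<close>.\<close>

lemma distribute_const_factor:
  assumes "prime_product S n c" "f \<in> T" "q \<in> T" "e \<in> T" "smult c f = q * e"
  shows "\<exists>a\<in>S. \<exists>b\<in>S. \<exists>q'\<in>T. \<exists>e'\<in>T. a \<noteq> 0 \<and> b \<noteq> 0 \<and>
    e = smult a e' \<and> q = smult b q' \<and> f = q' * e'"
  using assms
proof (induction arbitrary: q e)
  case (unit u)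
  then obtain v where v: "v \<in> S" "1 = u * v" by (auto simp: dvd_in_def)
  have "f = smult v (smult u f)" using v by (simp add: mult.commute)
  then have "f = smult v q * e" using unit by simp
  moreover have "q = smult u (smult v q)" using v by simp
  moreover have "u \<noteq> 0" using v by auto
  moreover have "e = smult 1 e" by simp
  moreover have "smult v q \<in> T" using unit.prems v poly_smult_closed by blast
  ultimately show ?case using unit.prems(3) unit.hyps(1) one_closed one_neq_zero by blast
next
  case (prime p n c)
  have p: "p \<in> S" "p \<noteq> 0" using prime.hyps by (auto simp: prime_in_def)
  have cS: "c \<in> S" using prime.hyps(2) by (rule prime_product_closed)
  have "q * e = [:p:] * smult c f" using prime.prems by (simp add: mult.commute)
  then have "dvd_in T [:p:] (q * e)"
    using poly_smult_closed[OF cS prime.prems(1)] by (intro dvd_inI[of "smult c f"])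
  then consider "dvd_in T [:p:] q" | "dvd_in T [:p:] e"
    using prime_in_const[OF prime.hyps(1)] prime.prems by (auto simp: prime_in_def)
  then show ?case
  proof cases
    case 1
    then obtain q1 where q1: "q1 \<in> T" "q = smult p q1" by (auto simp: dvd_in_def)
    have "smult p (smult c f) = smult p (q1 * e)" using prime.prems q1 by simp
    then have "smult c f = q1 * e" using p smult_cancel_left by blast
    then obtain a b q' e' where "a \<in> S" "b \<in> S" "q' \<in> T" "e' \<in> T" "a \<noteq> 0" "b \<noteq> 0"
      "e = smult a e'" "q1 = smult b q'" "f = q' * e'"
      using prime.IH[OF prime.prems(1) q1(1) prime.prems(3)] by blast
    moreover from this have "q = smult (p * b) q'" "p * b \<in> S" "p * b \<noteq> 0"
      using q1 p mult_closed by auto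
    ultimately show ?thesis by blast
  next
    case 2
    then obtain e1 where e1: "e1 \<in> T" "e = smult p e1" by (auto simp: dvd_in_def)
    have "smult p (smult c f) = smult p (q * e1)" using prime.prems e1 by simp
    then have "smult c f = q * e1" using p smult_cancel_left by blast
    then obtain a b q' e' where "a \<in> S" "b \<in> S" "q' \<in> T" "e' \<in> T" "a \<noteq> 0" "b \<noteq> 0"
      "e1 = smult a e'" "q = smult b q'" "f = q' * e'"
      using prime.IH[OF prime.prems(1,2) e1(1)] by blast
    moreover from this have "e = smult (p * a) e'" "p * a \<in> S" "p * a \<noteq> 0"
      using e1 p mult_closed by auto
    ultimately show ?thesis by blast
  qed
qed

text \<open>The content is a unit, expressed through primes so that no gcd of coefficients in
  \<open>S\<close> has to be formed.\<close>

definition primitive_over :: "'a poly \<Rightarrow> bool" where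
  "primitive_over f \<longleftrightarrow> (\<forall>p. prime_in S p \<longrightarrow> \<not> dvd_in T [:p:] f)"

lemma primitive_over_const_dvd:
  assumes "primitive_over f" "f = smult a g" "f \<noteq> 0" "a \<in> S" "g \<in> T"
  shows "dvd_in S a 1"
proof (rule ccontr)
  assume "\<not> dvd_in S a 1"
  moreover have "a \<noteq> 0" using assms by auto
  ultimately obtain p b where p: "prime_in S p" "b \<in> S" "a = p * b"
    using prime_divisor_exists_in[of a] assms by (auto simp: dvd_in_def)
  then have "f = [:p:] * smult b g" using assms by (simp add: mult.commute)
  then have "dvd_in T [:p:] f" using p assms poly_smult_closed by (intro dvd_inI[of "smult b g"]) auto
  then show False using assms p by (auto simp: primitive_over_def)
qed

text \<open>When \<open>c\<close> is distributed between \<open>f\<close> and the cofactor, the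
  share \<open>a\<close> that falls to \<open>f\<close> is a unit because \<open>f\<close> is
  primitive.\<close>

lemma primitive_over_cancel_const:
  assumes f: "f \<in> T" "primitive_over f" "f \<noteq> 0"
    and g: "g \<in> T" "c \<in> S" "c \<noteq> 0" "dvd_in T f (smult c g)"
  shows "dvd_in T f g"
proof -
  obtain n where n: "prime_product S n c" using factorization g by blast
  obtain q where q: "q \<in> T" "smult c g = q * f" using g by (auto simp: dvd_in_def mult.commute)
  obtain a b q' f' where *: "a \<in> S" "q' \<in> T" "f' \<in> T" "f = smult a f'" "g = q' * f'"
    using distribute_const_factor[OF n g(1) q(1) f(1) q(2)] by blast
  then obtain v where v: "v \<in> S" "1 = a * v"
    using primitive_over_const_dvd[of f a f'] f by (auto simp: dvd_in_def)
  have "f' = smult v f" using *(4) v by (simp add: mult.commute)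
  then have "g = f * smult v q'" unfolding *(5) by (simp add: mult.commute)
  then show ?thesis using poly_smult_closed[OF v(1) *(2)] by (intro dvd_inI[of "smult v q'"])
qed

text \<open>
  If \<open>f\<close> does not divide \<open>g\<close>, then irreducibility of \<open>f\<close> forces a pseudo-generator \<open>e\<close> of the ideal
  \<open>(f, g)\<close> to be a constant, and this constant can be cancelled from \<open>f dvd e * h\<close>.  No fraction
  field is needed.
\<close>

lemma primitive_irreducible_prime:
  assumes f: "f \<in> T" "degree f > 0" "primitive_over f"
    and irr: "\<And>g h. g \<in> T \<Longrightarrow> h \<in> T \<Longrightarrow> f = g * h \<Longrightarrow> degree g = 0 \<or> degree h = 0"
  shows "prime_in T f"
proof -
  have f0: "f \<noteq> 0" using f by auto
  have "\<not> dvd_in T f 1"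
  proof
    assume "dvd_in T f 1"
    then obtain g where "1 = f * g" by (auto simp: dvd_in_def)
    then have "degree (1::'a poly) = degree f + degree g"
      by (metis degree_mult_eq mult_eq_0_iff zero_neq_one)
    then show False using f by simp
  qed
  moreover have "dvd_in T f g \<or> dvd_in T f h"
    if gh: "g \<in> T" "h \<in> T" "dvd_in T f (g * h)" for g h
  proof -
    define J where "J = {u * f + v * g | u v. u \<in> T \<and> v \<in> T}"
    have 1: "f \<in> J" unfolding J_def using poly_one_closed monom_closed[OF zero_closed, of 0] by force
    have 2: "g \<in> J" unfolding J_def using poly_one_closed monom_closed[OF zero_closed, of 0] by force
    have "\<exists>e\<in>J. e \<noteq> 0 \<and> (\<forall>f\<in>J. \<exists>c\<in>S. c \<noteq> 0 \<and> dvd_in T e (smult c f))"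
    proof (rule ideal_pseudo_generator)
      show "J \<subseteq> T" using f gh by (auto simp: J_def intro: poly_add_closed poly_mult_closed)
      show "x - y \<in> J" if xy: "x \<in> J" "y \<in> J" for x y
      proof -
        obtain u v u' v' where *: "x = u * f + v * g" "y = u' * f + v' * g"
          "u \<in> T" "v \<in> T" "u' \<in> T" "v' \<in> T" using xy unfolding J_def by blast
        then have "x - y = (u - u') * f + (v - v') * g" by (simp add: algebra_simps)
        then show ?thesis using * poly_diff_closed by (auto simp: J_def)
      qed
      show "x * y \<in> J" if xy: "x \<in> T" "y \<in> J" for x y
      proof -
        obtain u v where *: "y = u * f + v * g" "u \<in> T" "v \<in> T" using xy unfolding J_def by blast
        then have "x * y = (x * u) * f + (x * v) * g" by (simp add: algebra_simps)
        then show ?thesis using * xy(1) poly_mult_closed by (auto simp: J_def)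
      qed
    qed (use 1 f0 in auto)
    then obtain e where e: "e \<in> J" "e \<noteq> 0" "\<And>f. f \<in> J \<Longrightarrow> \<exists>c\<in>S. c \<noteq> 0 \<and> dvd_in T e (smult c f)"
      by blast
    obtain u v where uv: "e = u * f + v * g" "u \<in> T" "v \<in> T" using e by (auto simp: J_def)
    have eT: "e \<in> T" using uv f gh by (auto intro: poly_add_closed poly_mult_closed)
    obtain c q where c: "c \<in> S" "c \<noteq> 0" "q \<in> T" "smult c f = q * e"
      using e(3)[OF 1] by (auto simp: dvd_in_def mult.commute)
    obtain n where "prime_product S n c" using factorization c by blast
    then obtain a b q' e' where *: "a \<in> S" "b \<in> S" "q' \<in> T" "e' \<in> T" "a \<noteq> 0"
      "e = smult a e'" "f = q' * e'"
      using distribute_const_factor[OF _ f(1) c(3) eT c(4)] by blast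
    \<comment> \<open>A constant \<open>q'\<close> is a unit by primitivity, so \<open>e'\<close>
      and \<open>f\<close> are associates and \<open>f\<close> divides \<open>e\<close>, hence also
      a constant multiple of \<open>g\<close>. This is the case in which \<open>f\<close> divides
      \<open>g\<close>.\<close>
    consider "degree q' = 0" | "degree e' = 0" using irr[OF *(3,4,7)] by metis
    then show ?thesis
    proof cases
      case 1
      then obtain w where w: "q' = [:w:]" using degree_eq_zeroE by blast
      have wS: "w \<in> S" using coeff_closed[OF *(3), of 0] w by simp
      have fw: "f = smult w e'" using * w by simp
      then obtain w' where w': "w' \<in> S" "1 = w * w'"
        using primitive_over_const_dvd[OF f(3) fw f0 wS *(4)] by (auto simp: dvd_in_def)
      have "e' = smult (w' * w) e'" using w'(2) by (metis mult.commute smult_1_left)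
      also have "\<dots> = smult w' f" unfolding fw by simp
      finally have "e = smult (a * w') f" using *(6) by simp
      then have "e = f * [:a * w':]" by simp
      then have fe: "dvd_in T f e" using * w' by (intro dvd_inI[of "[:a * w':]"] const_closed mult_closed)
      obtain c' q2 where c': "c' \<in> S" "c' \<noteq> 0" "q2 \<in> T" "smult c' g = e * q2"
        using e(3)[OF 2] by (auto simp: dvd_in_def)
      obtain k where "k \<in> T" "e = f * k" using fe by (auto simp: dvd_in_def)
      then have "smult c' g = f * (k * q2)" using c' by (simp add: mult.assoc)
      then have "dvd_in T f (smult c' g)"
        using \<open>k \<in> T\<close> c' poly_mult_closed by (auto simp: dvd_in_def)
      then show ?thesis using primitive_over_cancel_const[OF f(1,3) f0 gh(1) c'(1,2)] by blast
    next
      case 2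
      then obtain w where w: "e' = [:w:]" using degree_eq_zeroE by blast
      have wS: "w \<in> S" using coeff_closed[OF *(4), of 0] w by simp
      have ew: "e = [:a * w:]" using * w by simp
      then have aw: "a * w \<in> S" "a * w \<noteq> 0" using * wS e(2) mult_closed by auto
      obtain k where k: "k \<in> T" "g * h = f * k" using gh by (auto simp: dvd_in_def)
      have "smult (a * w) h = e * h" using ew by simp
      also have "\<dots> = u * h * f + v * (g * h)" unfolding uv by (simp add: algebra_simps)
      also have "\<dots> = f * (u * h + v * k)" unfolding k by (simp add: algebra_simps)
      finally have "dvd_in T f (smult (a * w) h)"
        using uv gh k by (intro dvd_inI[of "u * h + v * k"] poly_add_closed poly_mult_closed)
      then show ?thesis using primitive_over_cancel_const[OF f(1,3) f0 gh(2) aw] by blast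
    qed
  qed
  ultimately show ?thesis using f f0 by (auto simp: prime_in_def)
qed

text \<open>Splitting off a prime from \<open>f\<close> also removes it from the leading
  coefficient, whose number of prime factors therefore bounds the process.\<close>

lemma primitive_part_exists:
  assumes "f \<in> T" "f \<noteq> 0"
  shows "\<exists>c\<in>S. \<exists>g\<in>T. c \<noteq> 0 \<and> f = smult c g \<and> primitive_over g"
proof -
  obtain n where "prime_product S n (lead_coeff f)"
    using factorization assms coeff_closed by (metis leading_coeff_0_iff)
  then show ?thesis using assms
  proof (induction n arbitrary: f rule: less_induct)
    case (less n)
    show ?case
    proof (cases "primitive_over f")
      case True
      then show ?thesis using less one_closed by (metis smult_1_left one_neq_zero)
    next
      case False
      then obtain p g where p: "prime_in S p" "g \<in> T" "f = smult p g"
        by (auto simp: primitive_over_def dvd_in_def)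
      have p0: "p \<noteq> 0" "p \<in> S" using p by (auto simp: prime_in_def)
      then have "lead_coeff f = p * lead_coeff g" using p by simp
      then obtain m where m: "n = Suc m" "prime_product S m (lead_coeff g)"
        using prime_product_cancel[OF less.prems(1) _ p(1)] coeff_closed[OF p(2)] by blast
      have "g \<noteq> 0" using p less by auto
      then obtain c h where "c \<in> S" "h \<in> T" "c \<noteq> 0" "g = smult c h" "primitive_over h"
        using less.IH[OF _ m(2) p(2)] m(1) by auto
      moreover from this have "f = smult (p * c) h" "p * c \<in> S" "p * c \<noteq> 0"
        using p p0 mult_closed by auto
      ultimately show ?thesis by blast
    qed
  qed
qed

text \<open>At this point \<open>T\<close> is not yet known to be factorial, so the facts about
  prime products proved for \<open>S\<close> cannot be instantiated and the unit case is
  repeated.\<close>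

lemma polys_over_prime_product_mult:
  assumes "prime_product T n a" "prime_product T m b"
  shows "\<exists>k. prime_product T k (a * b)"
  using assms(1)
proof induction
  case (unit u)
  have "prime_product T m (u * b)" using assms(2)
  proof induction
    case (unit w)
    obtain x y where "x \<in> T" "1 = u * x" "y \<in> T" "1 = w * y"
      using unit \<open>dvd_in T u 1\<close> by (auto simp: dvd_in_def)
    then have "x * y \<in> T" "1 = (u * w) * (x * y)"
      by (auto intro: poly_mult_closed simp: mult.commute mult.left_commute)
    then have "dvd_in T (u * w) 1" by (rule dvd_inI)
    then show ?case using unit \<open>u \<in> T\<close> by (intro prime_product.unit poly_mult_closed)
  next
    case (prime p n a)
    then show ?case using prime_product.prime[of T p n "u * a"] by (simp add: mult.left_commute)
  qed
  then show ?case by blast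
next
  case (prime p n a)
  then show ?case using prime_product.prime by (metis mult.assoc)
qed

text \<open>Induction on the degree. After removal of the content, the primitive part is constant,
  or splits into factors of smaller degree, or is prime by
  \<open>primitive_irreducible_prime\<close>.\<close>

theorem ufd_subring_polys_over: "ufd_subring T"
proof
  show "1 \<in> T" by (rule poly_one_closed)
  show "a - b \<in> T" "a * b \<in> T" if "a \<in> T" "b \<in> T" for a b
    using that poly_diff_closed poly_mult_closed by auto
  show "\<exists>n. prime_product T n f" if "f \<in> T" "f \<noteq> 0" for f
    using that
  proof (induction "degree f" arbitrary: f rule: less_induct)
    case less
    obtain c g where c: "c \<in> S" "g \<in> T" "c \<noteq> 0" "f = smult c g" "primitive_over g"
      using primitive_part_exists[OF less.prems] by blast
    have g0: "g \<noteq> 0" using c less.prems by auto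
    have "\<exists>n. prime_product T n g"
    proof (cases "degree g = 0")
      case True
      then obtain w where w: "g = [:w:]" using degree_eq_zeroE by blast
      then have "w \<in> S" using coeff_closed[OF c(2), of 0] by simp
      then show ?thesis using factorization[of w] w g0 prime_product_const by auto
    next
      case False
      show ?thesis
      proof (cases "\<exists>h k. h \<in> T \<and> k \<in> T \<and> g = h * k \<and> degree h > 0 \<and> degree k > 0")
        case True
        then obtain h k where hk: "h \<in> T" "k \<in> T" "g = h * k" "degree h > 0" "degree k > 0" by blast
        have "degree f = degree h + degree k" using c hk g0 by (auto simp: degree_mult_eq)
        then obtain n m where "prime_product T n h" "prime_product T m k"
          using less.hyps[of h] less.hyps[of k] hk g0 by fastforce
        then show ?thesis using polys_over_prime_product_mult hk by blast
      next
        case no: False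
        then have "prime_in T g" using primitive_irreducible_prime[OF c(2) _ c(5)] False by auto
        moreover have "prime_product T 0 1"
          using poly_one_closed by (intro prime_product.unit) (auto simp: dvd_in_def)
        ultimately show ?thesis using prime_product.prime[of T g 0 1] by auto
      qed
    qed
    moreover obtain m where "prime_product T m [:c:]" using factorization c prime_product_const by blast
    ultimately show ?case using polys_over_prime_product_mult c by fastforce
  qed
qed

section \<open>Elimination of the last variable\<close>

lemma nonconstant_prime_divisor_exists:
  assumes "prime_product T n f" "degree f > 0"
  shows "\<exists>p. prime_in T p \<and> degree p > 0 \<and> dvd_in T p f"
  using assms
proof induction
  case (unit u)
  then obtain v where "1 = u * v" by (auto simp: dvd_in_def)
  then have "degree (1::'a poly) = degree u + degree v"
    by (metis degree_mult_eq mult_eq_0_iff zero_neq_one)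
  then show ?case using unit by simp
next
  case (prime p n a)
  have aT: "a \<in> T"
    using ufd_subring.prime_product_closed[OF ufd_subring_polys_over prime.hyps(2)] .
  have pT: "p \<in> T" using prime.hyps by (auto simp: prime_in_def)
  show ?case
  proof (cases "degree p > 0")
    case True
    then show ?thesis using prime.hyps aT by (auto simp: dvd_in_def)
  next
    case False
    then have "degree a > 0" using prime.prems degree_mult_le[of p a] by auto
    then obtain q where "prime_in T q" "degree q > 0" "dvd_in T q a" using prime.IH by blast
    then show ?thesis using pT by (metis ufd_subring.dvd_in_mult_left ufd_subring_polys_over)
  qed
qed

text \<open>The ideal generated by \<open>F\<close> has a pseudo-generator \<open>e\<close>. A
  nonconstant prime divisor of \<open>e\<close> divides a nonzero constant multiple of each
  \<open>f\<close> in \<open>F\<close>; it cannot divide the constant, so it divides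
  \<open>f\<close>, against coprimality. Hence \<open>e\<close> is itself the required
  constant.\<close>

theorem elimination:
  assumes F: "finite F" "F \<subseteq> T" "\<exists>f\<in>F. f \<noteq> 0"
    and coprime: "\<And>d. d \<in> T \<Longrightarrow> (\<And>f. f \<in> F \<Longrightarrow> dvd_in T d f) \<Longrightarrow> degree d = 0"
  shows "\<exists>a\<in>S. \<exists>u. a \<noteq> 0 \<and> (\<forall>f\<in>F. u f \<in> T) \<and> [:a:] = (\<Sum>f\<in>F. u f * f)"
proof -
  define J where "J = {\<Sum>f\<in>F. u f * f | u. \<forall>f\<in>F. u f \<in> T}"
  have FJ: "f \<in> J" if "f \<in> F" for f
  proof -
    have "(\<Sum>g\<in>F. (if g = f then 1 else 0) * g) = f"
      using that F(1) by (simp add: if_distrib[of "\<lambda>x. x * _"] cong: if_cong)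
    moreover have "(0::'a poly) \<in> T" by (simp add: polys_over_def zero_closed)
    ultimately show ?thesis using poly_one_closed
      by (auto simp: J_def intro!: exI[of _ "\<lambda>g. if g = f then 1 else 0"])
  qed
  have JT: "J \<subseteq> T"
    using F(2) by (auto simp: J_def intro!: ufd_subring.sum_closed[OF ufd_subring_polys_over] poly_mult_closed)
  have "\<exists>e\<in>J. e \<noteq> 0 \<and> (\<forall>f\<in>J. \<exists>c\<in>S. c \<noteq> 0 \<and> dvd_in T e (smult c f))"
  proof (rule ideal_pseudo_generator[OF JT])
    show "x - y \<in> J" if xy: "x \<in> J" "y \<in> J" for x y
    proof -
      obtain u v where "x = (\<Sum>f\<in>F. u f * f)" "y = (\<Sum>f\<in>F. v f * f)"
        "\<forall>f\<in>F. u f \<in> T" "\<forall>f\<in>F. v f \<in> T" using xy unfolding J_def by blast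
      then have "x - y = (\<Sum>f\<in>F. (u f - v f) * f)" "\<forall>f\<in>F. u f - v f \<in> T"
        by (auto simp: left_diff_distrib sum_subtractf intro: poly_diff_closed)
      then show ?thesis by (auto simp: J_def)
    qed
    show "x * y \<in> J" if xy: "x \<in> T" "y \<in> J" for x y
    proof -
      obtain u where "y = (\<Sum>f\<in>F. u f * f)" "\<forall>f\<in>F. u f \<in> T" using xy unfolding J_def by blast
      then have "x * y = (\<Sum>f\<in>F. (x * u f) * f)" "\<forall>f\<in>F. x * u f \<in> T"
        using xy by (auto simp: sum_distrib_left mult.assoc intro: poly_mult_closed)
      then show ?thesis by (auto simp: J_def)
    qed
    show "\<exists>f\<in>J. f \<noteq> 0" using F FJ by blast
  qed
  then obtain e where e: "e \<in> J" "e \<noteq> 0" "\<And>f. f \<in> J \<Longrightarrow> \<exists>c\<in>S. c \<noteq> 0 \<and> dvd_in T e (smult c f)"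
    by blast
  have "degree e = 0"
  proof (rule ccontr)
    assume "degree e \<noteq> 0"
    moreover obtain n where "prime_product T n e"
      using e JT ufd_subring.factorization[OF ufd_subring_polys_over] by blast
    ultimately obtain p where p: "prime_in T p" "degree p > 0" "dvd_in T p e"
      using nonconstant_prime_divisor_exists by blast
    have "dvd_in T p f" if f: "f \<in> F" for f
    proof -
      obtain c where c: "c \<in> S" "c \<noteq> 0" "dvd_in T e (smult c f)" using e(3) FJ f by blast
      then have "dvd_in T p ([:c:] * f)"
        using p ufd_subring.dvd_in_trans[OF ufd_subring_polys_over] by simp
      then have "dvd_in T p [:c:] \<or> dvd_in T p f"
        using p f F(2) const_closed c unfolding prime_in_def by blast
      moreover have "\<not> dvd_in T p [:c:]"
      proof
        assume "dvd_in T p [:c:]"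
        then obtain k where k: "[:c:] = p * k" by (auto simp: dvd_in_def)
        then have "k \<noteq> 0" "p \<noteq> 0" using c by auto
        then have "degree [:c:] = degree p + degree k" unfolding k by (rule degree_mult_eq[rotated])
        then show False using p by simp
      qed
      ultimately show ?thesis by blast
    qed
    then have "degree p = 0" using coprime p by (auto simp: prime_in_def)
    then show False using p by simp
  qed
  then obtain a where a: "e = [:a:]" using degree_eq_zeroE by blast
  then have "a \<in> S" "a \<noteq> 0" using e JT coeff_closed[of e 0] by auto
  then show ?thesis using e(1) a by (auto simp: J_def)
qed

end

section \<open>Multivariate polynomials as iterated polynomials\<close>

text \<open>Adjoining a variable through \<open>poly\<close> changes the type. Evaluation at the new
  variable, which is injective on \<open>polys_over (mpolys r)\<close>, carries factoriality and
  divisibility back to the type of multivariate polynomials.\<close>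

lemma ufd_subring_image:
  assumes T: "ufd_subring T"
    and \<phi>: "\<phi> 1 = 1" "\<And>a b. a \<in> T \<Longrightarrow> b \<in> T \<Longrightarrow> \<phi> (a - b) = \<phi> a - \<phi> b"
      "\<And>a b. a \<in> T \<Longrightarrow> b \<in> T \<Longrightarrow> \<phi> (a * b) = \<phi> a * \<phi> b"
      "\<And>a. a \<in> T \<Longrightarrow> \<phi> a = 0 \<Longrightarrow> a = 0"
  shows "ufd_subring (\<phi> ` T)"
    and "\<And>a b. a \<in> T \<Longrightarrow> b \<in> T \<Longrightarrow> dvd_in (\<phi> ` T) (\<phi> a) (\<phi> b) \<longleftrightarrow> dvd_in T a b"
proof -
  interpret ufd_subring T by fact
  have inj: "a = b" if "a \<in> T" "b \<in> T" "\<phi> a = \<phi> b" for a b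
    using \<phi>(4)[of "a - b"] \<phi>(2)[of a b] that diff_closed by simp
  have \<phi>0: "\<phi> 0 = 0" using \<phi>(2)[OF one_closed one_closed] by simp
  show dvd: "dvd_in (\<phi> ` T) (\<phi> a) (\<phi> b) \<longleftrightarrow> dvd_in T a b" if "a \<in> T" "b \<in> T" for a b
  proof
    assume "dvd_in (\<phi> ` T) (\<phi> a) (\<phi> b)"
    then obtain c where c: "c \<in> T" "\<phi> b = \<phi> a * \<phi> c" by (auto simp: dvd_in_def)
    then have "b = a * c" using \<phi>(3) inj[OF that(2) mult_closed[OF that(1) c(1)]] that by simp
    then show "dvd_in T a b" using c by (auto simp: dvd_in_def)
  next
    assume "dvd_in T a b"
    then show "dvd_in (\<phi> ` T) (\<phi> a) (\<phi> b)" using \<phi>(3) that by (auto simp: dvd_in_def)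
  qed
  have prime_image: "prime_in (\<phi> ` T) (\<phi> p)" if p: "prime_in T p" for p
  proof -
    have pT: "p \<in> T" using p by (simp add: prime_in_def)
    have "\<not> dvd_in (\<phi> ` T) (\<phi> p) 1"
      using dvd[OF pT one_closed] \<phi>(1) p by (auto simp: prime_in_def)
    moreover have "dvd_in (\<phi> ` T) (\<phi> p) (\<phi> a) \<or> dvd_in (\<phi> ` T) (\<phi> p) (\<phi> b)"
      if ab: "a \<in> T" "b \<in> T" "dvd_in (\<phi> ` T) (\<phi> p) (\<phi> a * \<phi> b)" for a b
    proof -
      have "dvd_in T p (a * b)"
        using ab dvd[OF pT mult_closed[OF ab(1,2)]] \<phi>(3)[OF ab(1,2)] by simp
      then show ?thesis using p ab dvd[OF pT] by (auto simp: prime_in_def)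
    qed
    ultimately show ?thesis using p \<phi>(4) by (auto simp: prime_in_def)
  qed
  have pp: "prime_product (\<phi> ` T) n (\<phi> a)" if "prime_product T n a" for n a
    using that
  proof induction
    case (unit u)
    then show ?case using dvd[OF _ one_closed] \<phi>(1) by (auto intro: prime_product.unit)
  next
    case (prime p n a)
    then have "a \<in> T" "p \<in> T" using prime_product_closed by (auto simp: prime_in_def)
    then show ?case
      using prime_product.prime[OF prime_image[OF prime.hyps(1)] prime.IH] \<phi>(3) by simp
  qed
  show "ufd_subring (\<phi> ` T)"
  proof
    show "1 \<in> \<phi> ` T" using one_closed \<phi>(1) by force
    fix x y assume "x \<in> \<phi> ` T" "y \<in> \<phi> ` T"
    then obtain a b where ab: "a \<in> T" "b \<in> T" "x = \<phi> a" "y = \<phi> b" by blast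
    then show "x - y \<in> \<phi> ` T" "x * y \<in> \<phi> ` T"
      using \<phi>(2,3)[OF ab(1,2), symmetric] diff_closed mult_closed by auto
  next
    fix x assume x: "x \<in> \<phi> ` T" "x \<noteq> 0"
    then obtain a where "a \<in> T" "x = \<phi> a" by blast
    then show "\<exists>n. prime_product (\<phi> ` T) n x" using factorization[of a] x pp \<phi>0 by blast
  qed
qed

lemma ufd_subring_int: "ufd_subring (UNIV :: int set)"
proof
  have dvd: "dvd_in UNIV = ((dvd) :: int \<Rightarrow> int \<Rightarrow> bool)"
    by (auto simp: dvd_in_def dvd_def fun_eq_iff)
  show "\<exists>n. prime_product UNIV n a" if "a \<noteq> 0" for a :: int
    using that
  proof (induction a rule: prime_divisors_induct)
    case (unit x)
    then show ?case using prime_product.unit[of x UNIV] by (auto simp: dvd)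
  next
    case (factor p x)
    then have "prime_in UNIV p"
      by (auto simp: prime_in_def dvd prime_dvd_mult_iff)
    then show ?case using factor prime_product.prime by (metis mult_zero_right)
  qed simp
qed simp_all

section \<open>Supports, arithmetic and evaluation of multivariate polynomials\<close>

definition mpoly_var :: "nat \<Rightarrow> 'a::comm_semiring_1 mpoly" where
  "mpoly_var r = Poly_Mapping.single (Poly_Mapping.single r 1) 1"

lemma mpoly_var_power:
  "mpoly_var r ^ k = Poly_Mapping.single (Poly_Mapping.single r k) 1"
  by (induction k) (simp_all add: mpoly_var_def mult_single single_add[symmetric])

lemma poly_mapping_sum_single:
  "(p :: 'k \<Rightarrow>\<^sub>0 'a::comm_monoid_add) = (\<Sum>m\<in>Poly_Mapping.keys p. Poly_Mapping.single m (Poly_Mapping.lookup p m))"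
proof (rule poly_mapping_eqI)
  fix k
  show "Poly_Mapping.lookup p k = Poly_Mapping.lookup (\<Sum>m\<in>Poly_Mapping.keys p. Poly_Mapping.single m (Poly_Mapping.lookup p m)) k"
    by (simp add: lookup_sum lookup_single when_def in_keys_iff)
qed

text \<open>No case for 0 is needed, because \<open>Poly_Mapping.single m 0\<close> is 0.\<close>

lemma poly_mapping_sum_induct [case_names single add]:
  fixes p :: "'k \<Rightarrow>\<^sub>0 'a::comm_monoid_add"
  assumes single: "\<And>m c. P (Poly_Mapping.single m c)"
    and add: "\<And>p q. P p \<Longrightarrow> P q \<Longrightarrow> P (p + q)"
  shows "P p"
proof -
  have "P (\<Sum>m\<in>A. Poly_Mapping.single m (Poly_Mapping.lookup p m))" for A
  proof (induction A rule: infinite_finite_induct)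
    case (insert x F)
    then show ?case using assms by simp
  qed (use single[of undefined 0] in simp_all)
  then show ?thesis using poly_mapping_sum_single[of p] by metis
qed

lemma mpolysI: "(\<And>m. m \<in> Poly_Mapping.keys p \<Longrightarrow> Poly_Mapping.keys m \<subseteq> {..<r}) \<Longrightarrow> p \<in> mpolys r"
  by (auto simp: mpolys_def)

lemma mpolysD: "p \<in> mpolys r \<Longrightarrow> m \<in> Poly_Mapping.keys p \<Longrightarrow> Poly_Mapping.keys m \<subseteq> {..<r}"
  by (auto simp: mpolys_def)

lemma mpolys_zero: "0 \<in> mpolys r"
  by (simp add: mpolys_def)

lemma mpolys_single: "Poly_Mapping.keys m \<subseteq> {..<r} \<Longrightarrow> Poly_Mapping.single m c \<in> mpolys r"
  by (simp add: mpolys_def)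

lemma mpolys_add: "p \<in> mpolys r \<Longrightarrow> q \<in> mpolys r \<Longrightarrow> p + q \<in> mpolys r"
  using keys_add[of p q] by (auto simp: mpolys_def)

lemma mpolys_sum: "(\<And>i. i \<in> A \<Longrightarrow> f i \<in> mpolys r) \<Longrightarrow> sum f A \<in> mpolys r"
  by (induction A rule: infinite_finite_induct) (auto intro: mpolys_add mpolys_zero)

lemma keys_add_nat: "Poly_Mapping.keys (m + m' :: 'k \<Rightarrow>\<^sub>0 nat) = Poly_Mapping.keys m \<union> Poly_Mapping.keys m'"
  by (auto simp: in_keys_iff lookup_add)

lemma mpolys_mult:
  assumes "p \<in> mpolys r" "q \<in> mpolys r"
  shows "p * q \<in> mpolys r"
proof (rule mpolysI)
  fix m assume "m \<in> Poly_Mapping.keys (p * q)"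
  then obtain a b where "m = a + b" "a \<in> Poly_Mapping.keys p" "b \<in> Poly_Mapping.keys q" using keys_mult[of p q] by blast
  then show "Poly_Mapping.keys m \<subseteq> {..<r}" using assms by (auto simp: keys_add_nat dest!: mpolysD)
qed

lemma mpolys_mono: "p \<in> mpolys r \<Longrightarrow> r \<le> s \<Longrightarrow> p \<in> mpolys s"
  by (fastforce simp: mpolys_def)

lemma mpoly_var_power_mem: "mpoly_var r ^ k \<in> mpolys (Suc r)"
  unfolding mpoly_var_power by (rule mpolys_single) (simp split: if_splits)

lemma mpolys_0: "mpolys 0 = range (Poly_Mapping.single 0)"
proof (intro set_eqI iffI)
  fix p :: "'a mpoly" assume "p \<in> mpolys 0"
  then have "m = 0" if "m \<in> Poly_Mapping.keys p" for m
    using that by (auto simp: mpolys_def)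
  then have "p = Poly_Mapping.single 0 (Poly_Mapping.lookup p 0)"
    by (intro poly_mapping_eqI) (auto simp: lookup_single when_def in_keys_iff)
  then show "p \<in> range (Poly_Mapping.single 0)" by blast
qed (auto intro: mpolys_single)

definition monomial_eval :: "(nat \<Rightarrow> 'a::comm_semiring_1) \<Rightarrow> (nat \<Rightarrow>\<^sub>0 nat) \<Rightarrow> 'a" where
  "monomial_eval n m = (\<Prod>i\<in>Poly_Mapping.keys m. n i ^ Poly_Mapping.lookup m i)"

lemma monomial_eval_superset:
  assumes "finite A" "Poly_Mapping.keys m \<subseteq> A"
  shows "monomial_eval n m = (\<Prod>i\<in>A. n i ^ Poly_Mapping.lookup m i)"
  unfolding monomial_eval_def using assms
  by (intro prod.mono_neutral_left) (auto simp: in_keys_iff)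

lemma monomial_eval_add: "monomial_eval n (m + m') = monomial_eval n m * monomial_eval n m'"
proof -
  let ?A = "Poly_Mapping.keys m \<union> Poly_Mapping.keys m'"
  show ?thesis
    by (simp add: monomial_eval_superset[of ?A] keys_add_nat lookup_add power_add prod.distrib)
qed

lemma mpoly_eval_superset:
  assumes "finite A" "Poly_Mapping.keys p \<subseteq> A"
  shows "mpoly_eval p n = (\<Sum>m\<in>A. Poly_Mapping.lookup p m * monomial_eval n m)"
  unfolding mpoly_eval_def monomial_eval_def using assms
  by (intro sum.mono_neutral_left) (auto simp: in_keys_iff)

lemma mpoly_eval_add: "mpoly_eval (p + q) n = mpoly_eval p n + mpoly_eval q n"
proof -
  let ?A = "Poly_Mapping.keys p \<union> Poly_Mapping.keys q"
  show ?thesis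
    using keys_add[of p q]
    by (simp add: mpoly_eval_superset[of ?A] lookup_add distrib_right sum.distrib)
qed

lemma mpoly_eval_single: "mpoly_eval (Poly_Mapping.single m c) n = c * monomial_eval n m"
  by (simp add: mpoly_eval_superset[of "{m}"])

lemma mpoly_eval_zero: "mpoly_eval 0 n = 0"
  by (simp add: mpoly_eval_def)

lemma mpoly_eval_sum: "mpoly_eval (sum f A) n = (\<Sum>i\<in>A. mpoly_eval (f i) n)"
  by (induction A rule: infinite_finite_induct) (simp_all add: mpoly_eval_zero mpoly_eval_add)

lemma mpoly_eval_mult: "mpoly_eval (p * q) n = mpoly_eval p n * mpoly_eval q n"
proof (induction p rule: poly_mapping_sum_induct)
  case (single m c)
  show ?case
  proof (induction q rule: poly_mapping_sum_induct)
    case (single m' c')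
    show ?case by (simp add: mult_single mpoly_eval_single monomial_eval_add ac_simps)
  qed (simp add: distrib_left mpoly_eval_add)
qed (simp add: distrib_right mpoly_eval_add)

lemma mpoly_eval_var: "mpoly_eval (mpoly_var r) n = n r"
  by (simp add: mpoly_var_def mpoly_eval_single monomial_eval_def)

lemma mpoly_eval_poly_var:
  "mpoly_eval (poly p (mpoly_var r)) n = poly (map_poly (\<lambda>c. mpoly_eval c n) p) (n r)"
  by (induction p)
    (simp_all add: mpoly_eval_zero map_poly_pCons mpoly_eval_add mpoly_eval_mult mpoly_eval_var)

lemma mpoly_eval_cong:
  assumes "p \<in> mpolys r" "\<And>i. i < r \<Longrightarrow> n i = n' i"
  shows "mpoly_eval p n = mpoly_eval p n'"
  unfolding mpoly_eval_def using assms
  by (intro sum.cong prod.cong arg_cong2[of _ _ _ _ "(*)"]) (auto dest!: mpolysD)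

section \<open>Polynomials in r + 1 variables as polynomials in the last one\<close>

lemma lookup_mult_single:
  fixes p :: "'k::cancel_comm_monoid_add \<Rightarrow>\<^sub>0 'a::comm_semiring_1"
  shows "Poly_Mapping.lookup (p * Poly_Mapping.single t 1) (m + t) = Poly_Mapping.lookup p m"
proof (induction p rule: poly_mapping_sum_induct)
  case (single a c)
  then show ?case by (simp add: mult_single lookup_single when_def)
qed (simp add: distrib_right lookup_add)

lemma poly_var_closed:
  assumes "p \<in> polys_over (mpolys r)"
  shows "poly p (mpoly_var r) \<in> mpolys (Suc r)"
  unfolding poly_altdef using assms
  by (intro mpolys_sum mpolys_mult mpoly_var_power_mem)
    (auto simp: polys_over_def intro: mpolys_mono)

text \<open>The coefficients are free of the variable \<open>r\<close>, so every monomial of the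
  summand \<open>j\<close> has exponent exactly \<open>j\<close> there, and only
  \<open>j = k\<close> contributes. Injectivity of the evaluation follows.\<close>

lemma lookup_poly_var:
  assumes p: "p \<in> polys_over (mpolys r)" and m: "r \<notin> Poly_Mapping.keys m"
  shows "Poly_Mapping.lookup (poly p (mpoly_var r)) (m + Poly_Mapping.single r k) = Poly_Mapping.lookup (coeff p k) m"
proof -
  have other: "Poly_Mapping.lookup (coeff p j * mpoly_var r ^ j) (m + Poly_Mapping.single r k) = 0" if "j \<noteq> k" for j
  proof (rule ccontr)
    assume "\<not> ?thesis"
    then have "m + Poly_Mapping.single r k \<in> Poly_Mapping.keys (coeff p j * mpoly_var r ^ j)"
      by (simp add: in_keys_iff)
    then obtain a where a: "a \<in> Poly_Mapping.keys (coeff p j)"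
      "m + Poly_Mapping.single r k = a + Poly_Mapping.single r j"
      using keys_mult[of "coeff p j" "mpoly_var r ^ j"] by (auto simp: mpoly_var_power)
    have "r \<notin> Poly_Mapping.keys a" using a(1) p by (auto simp: polys_over_def dest!: mpolysD)
    then have "Poly_Mapping.lookup a r = 0" "Poly_Mapping.lookup m r = 0" using m by (auto simp: in_keys_iff)
    then show False using arg_cong[OF a(2), of "\<lambda>f. Poly_Mapping.lookup f r"] that by (simp add: lookup_add)
  qed
  have "Poly_Mapping.lookup (poly p (mpoly_var r)) (m + Poly_Mapping.single r k) =
      (\<Sum>j\<le>degree p. Poly_Mapping.lookup (coeff p j * mpoly_var r ^ j) (m + Poly_Mapping.single r k))"
    by (simp add: poly_altdef lookup_sum)
  also have "\<dots> = (\<Sum>j\<le>degree p. if j = k then Poly_Mapping.lookup (coeff p k) m else 0)"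
    using other by (intro sum.cong) (auto simp: mpoly_var_power lookup_mult_single)
  also have "\<dots> = Poly_Mapping.lookup (coeff p k) m"
    by (auto simp: coeff_eq_0)
  finally show ?thesis .
qed

lemma poly_var_eq_0:
  assumes "p \<in> polys_over (mpolys r)" "poly p (mpoly_var r) = 0"
  shows "p = 0"
proof (rule poly_eqI, rule poly_mapping_eqI)
  fix k m
  show "Poly_Mapping.lookup (coeff p k) m = Poly_Mapping.lookup (coeff 0 k) m"
  proof (cases "r \<in> Poly_Mapping.keys m")
    case True
    then have "m \<notin> Poly_Mapping.keys (coeff p k)" using assms by (auto simp: polys_over_def dest!: mpolysD)
    then show ?thesis by (simp add: in_keys_iff)
  next
    case False
    then show ?thesis using lookup_poly_var[OF assms(1) False, of k] assms(2) by simp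
  qed
qed

lemma single_split_var:
  "Poly_Mapping.single m c =
    Poly_Mapping.single (Poly_Mapping.update r 0 m) c * mpoly_var r ^ Poly_Mapping.lookup m r"
proof -
  have "m = Poly_Mapping.update r 0 m + Poly_Mapping.single r (Poly_Mapping.lookup m r)"
    by (intro poly_mapping_eqI) (simp add: lookup_add lookup_update lookup_single when_def)
  then show ?thesis by (metis mpoly_var_power mult_single mult.right_neutral)
qed

lemma mpolys_Suc: "mpolys (Suc r) = (\<lambda>p. poly p (mpoly_var r)) ` polys_over (mpolys r)"
proof (intro set_eqI iffI)
  fix f :: "'a mpoly" assume f: "f \<in> mpolys (Suc r)"
  \<comment> \<open>The monomials of \<open>f\<close> are grouped by their exponent of the variable
    \<open>r\<close>, which \<open>update r 0\<close> removes from the coefficient.\<close>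
  define p where "p = (\<Sum>m\<in>Poly_Mapping.keys f. monom (Poly_Mapping.single (Poly_Mapping.update r 0 m) (Poly_Mapping.lookup f m))
    (Poly_Mapping.lookup m r))"
  have "poly p (mpoly_var r) = (\<Sum>m\<in>Poly_Mapping.keys f. Poly_Mapping.single m (Poly_Mapping.lookup f m))"
    unfolding p_def by (simp add: poly_sum poly_monom single_split_var[symmetric])
  then have "f = poly p (mpoly_var r)" using poly_mapping_sum_single[of f] by simp
  moreover have "coeff p k \<in> mpolys r" for k
    unfolding p_def coeff_sum coeff_monom
  proof (rule mpolys_sum)
    fix m assume "m \<in> Poly_Mapping.keys f"
    then have "Poly_Mapping.keys m \<subseteq> {..<Suc r}" using f mpolysD by blast
    then have "Poly_Mapping.keys (Poly_Mapping.update r 0 m) \<subseteq> {..<r}"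
      by (auto simp: keys_update less_Suc_eq)
    then show "(if Poly_Mapping.lookup m r = k then Poly_Mapping.single (Poly_Mapping.update r 0 m) (Poly_Mapping.lookup f m) else 0)
        \<in> mpolys r"
      by (auto intro: mpolys_single mpolys_zero)
  qed
  ultimately show "f \<in> (\<lambda>p. poly p (mpoly_var r)) ` polys_over (mpolys r)"
    by (auto simp: polys_over_def)
qed (auto intro: poly_var_closed)

lemma ufd_subring_mpolys: "ufd_subring (mpolys r :: int mpoly set)"
proof (induction r)
  case 0
  show ?case unfolding mpolys_0
    by (rule ufd_subring_image(1)[OF ufd_subring_int])
      (simp_all add: single_diff mult_single, metis lookup_single_eq lookup_zero)
next
  case (Suc r)
  show ?case unfolding mpolys_Suc
    by (rule ufd_subring_image(1)[OF ufd_subring.ufd_subring_polys_over[OF Suc]])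
      (auto dest: poly_var_eq_0)
qed

lemma dvd_in_poly_var_iff:
  fixes p q :: "int mpoly poly"
  assumes "p \<in> polys_over (mpolys r)" "q \<in> polys_over (mpolys r)"
  shows "dvd_in (mpolys (Suc r)) (poly p (mpoly_var r)) (poly q (mpoly_var r)) \<longleftrightarrow>
    dvd_in (polys_over (mpolys r)) p q"
  unfolding mpolys_Suc
  by (rule ufd_subring_image(2)[OF ufd_subring.ufd_subring_polys_over[OF ufd_subring_mpolys]])
    (use assms in \<open>auto dest: poly_var_eq_0\<close>)

section \<open>Passage from integer to rational coefficients\<close>

lemma keys_rat_mpoly: "Poly_Mapping.keys (rat_mpoly p) = Poly_Mapping.keys p"
  by (auto simp: rat_mpoly_def in_keys_iff map.rep_eq when_def)

lemma lookup_rat_mpoly: "Poly_Mapping.lookup (rat_mpoly p) m = of_int (Poly_Mapping.lookup p m)"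
  by (auto simp: rat_mpoly_def map.rep_eq when_def)

lemma rat_mpoly_add: "rat_mpoly (p + q) = rat_mpoly p + rat_mpoly q"
  by (rule poly_mapping_eqI) (simp add: lookup_rat_mpoly lookup_add)

lemma rat_mpoly_single: "rat_mpoly (Poly_Mapping.single m c) = Poly_Mapping.single m (of_int c)"
  by (rule poly_mapping_eqI) (simp add: lookup_rat_mpoly lookup_single when_def)

lemma rat_mpoly_mult: "rat_mpoly (p * q) = rat_mpoly p * rat_mpoly q"
proof (induction p rule: poly_mapping_sum_induct)
  case (single m c)
  show ?case
    by (induction q rule: poly_mapping_sum_induct)
      (simp_all add: mult_single rat_mpoly_single distrib_left rat_mpoly_add)
qed (simp add: distrib_right rat_mpoly_add)

lemma rat_mpoly_closed: "p \<in> mpolys r \<Longrightarrow> rat_mpoly p \<in> mpolys r"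
  by (simp add: mpolys_def keys_rat_mpoly)

lemma mpoly_degree_pos:
  assumes "p \<notin> mpolys 0"
  shows "mpoly_degree p > 0"
proof -
  obtain m where m: "m \<in> Poly_Mapping.keys p" "Poly_Mapping.keys m \<noteq> {}" using assms by (auto simp: mpolys_def)
  then obtain i where "i \<in> Poly_Mapping.keys m" by blast
  then have "0 < Poly_Mapping.lookup m i" by (simp add: in_keys_iff)
  also have "\<dots> \<le> (\<Sum>i\<in>Poly_Mapping.keys m. Poly_Mapping.lookup m i)"
    using \<open>i \<in> Poly_Mapping.keys m\<close> by (intro member_le_sum) auto
  also have "\<dots> \<le> mpoly_degree p"
    unfolding mpoly_degree_def using m by (intro Max_ge) auto
  finally show ?thesis .
qed

text \<open>A common divisor over the integers is one over the rationals, so it cannot have positive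
  degree. More than constancy cannot be claimed: a nonunit integer may divide every
  \<open>P i\<close>.\<close>

lemma coprime_mpolys_common_divisor:
  assumes "coprime_mpolys r s P" "D \<in> mpolys r" "\<And>i. i < s \<Longrightarrow> dvd_in (mpolys r) D (P i)"
  shows "D \<in> mpolys 0"
proof (rule ccontr)
  assume "D \<notin> mpolys 0"
  then have "rat_mpoly D \<notin> mpolys 0" by (simp add: mpolys_def keys_rat_mpoly)
  moreover have "\<exists>Q\<in>mpolys r. rat_mpoly (P i) = rat_mpoly D * Q" if i: "i < s" for i
  proof -
    obtain Q where "Q \<in> mpolys r" "P i = D * Q" using assms(3)[OF i] by (auto simp: dvd_in_def)
    then show ?thesis using rat_mpoly_closed rat_mpoly_mult by metis
  qed
  ultimately show False
    using assms(1,2) mpoly_degree_pos rat_mpoly_closed unfolding coprime_mpolys_def by blast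
qed

section \<open>Values of coprime polynomials\<close>

lemma chinese_remainder_int:
  fixes m u :: "'a \<Rightarrow> int"
  assumes "finite A" "\<And>i j. i \<in> A \<Longrightarrow> j \<in> A \<Longrightarrow> i \<noteq> j \<Longrightarrow> coprime (m i) (m j)"
  shows "\<exists>x. \<forall>i\<in>A. [x = u i] (mod m i)"
  using assms
proof (induction A rule: finite_induct)
  case (insert a A)
  then obtain x where x: "\<forall>i\<in>A. [x = u i] (mod m i)" by auto
  have "coprime (m a) (\<Prod>i\<in>A. m i)"
    using insert by (intro prod_coprime_right) auto
  then obtain y where y: "[y = u a] (mod m a)" "[y = x] (mod (\<Prod>i\<in>A. m i))"
    using binary_chinese_remainder_int by blast
  have "[y = u i] (mod m i)" if "i \<in> A" for i
  proof -
    have "m i dvd (\<Prod>i\<in>A. m i)" using that insert by (intro dvd_prodI) auto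
    then have "[y = x] (mod m i)" using y(2) cong_dvd_modulus by blast
    then show ?thesis using x that cong_trans by blast
  qed
  then show ?case using y(1) by auto
qed simp

lemma cong_poly:
  fixes x y :: int
  assumes "[x = y] (mod m)"
  shows "[poly f x = poly f y] (mod m)"
proof (induction f)
  case (pCons a f)
  then show ?case unfolding poly_pCons by (intro cong_add cong_mult cong_refl assms)
qed simp

text \<open>Lagrange's bound on the number of roots modulo \<open>p\<close>, proved over the
  integers: synthetic division splits off a root, and the remainder \<open>poly g x\<close> is
  divisible by \<open>p\<close> instead of being 0.\<close>

lemma prime_dvd_coeff_if_many_roots:
  fixes p :: int and g :: "int poly"
  assumes p: "prime p" and "finite X" "card X > degree g"
    and "\<And>x y. x \<in> X \<Longrightarrow> y \<in> X \<Longrightarrow> x \<noteq> y \<Longrightarrow> \<not> p dvd x - y"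
    and "\<And>x. x \<in> X \<Longrightarrow> p dvd poly g x"
  shows "[:p:] dvd g"
  using assms(2-)
proof (induction "degree g" arbitrary: g X)
  case 0
  then obtain c where "g = [:c:]" using degree_eq_zeroE by metis
  moreover obtain x where "x \<in> X" using 0 by fastforce
  ultimately show ?case using 0 by (auto simp: const_poly_dvd_const_poly_iff)
next
  case (Suc n)
  obtain x where x: "x \<in> X" using Suc.prems(2) by fastforce
  define q where "q = synthetic_div g x"
  have g: "[:- x, 1:] * q + [:poly g x:] = g"
    unfolding q_def by (rule synthetic_div_correct')
  have "p dvd poly q y" if y: "y \<in> X - {x}" for y
  proof -
    have "poly g y = (y - x) * poly q y + poly g x"
      by (subst g[symmetric]) (simp add: algebra_simps)
    then have "p dvd (y - x) * poly q y"
      using Suc.prems(4)[of x] Suc.prems(4)[of y] x y by (metis DiffD1 dvd_add_left_iff)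
    then show ?thesis using Suc.prems(3)[of y x] x y p by (auto simp: prime_dvd_mult_iff)
  qed
  moreover have "degree q = n" using Suc.hyps(2) by (simp add: q_def degree_synthetic_div)
  moreover have "card (X - {x}) > n" using Suc.hyps(2) Suc.prems x by simp
  ultimately have "[:p:] dvd q"
    using Suc.prems by (intro Suc.hyps(1)[of q "X - {x}"]) auto
  moreover have "[:p:] dvd [:poly g x:]"
    using Suc.prems(4)[OF x] by (simp add: const_poly_dvd_const_poly_iff)
  ultimately show ?case by (subst g[symmetric]) (intro dvd_add dvd_mult)
qed

text \<open>The residues from 0 to \<open>p - 1\<close> would be too many roots. The bound on the
  degree excludes polynomials such as \<open>y^p - y\<close>, which vanish at every residue.\<close>

lemma nonroot_mod_prime_exists:
  fixes p :: int and g :: "int poly"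
  assumes "prime p" "\<not> p dvd coeff g k" "int (degree g) < p"
  shows "\<exists>y. \<not> p dvd poly g y"
proof (rule ccontr)
  assume "\<not> ?thesis"
  moreover have "\<not> p dvd x - y" if "x \<in> {0..<p}" "y \<in> {0..<p}" "x \<noteq> y" for x y
    using that zdvd_not_zless[of "x - y" p] zdvd_not_zless[of "y - x" p] dvd_diff_commute[of p x y]
    by (cases "x < y") auto
  ultimately have "[:p:] dvd g"
    using assms by (intro prime_dvd_coeff_if_many_roots[of p "{0..<p}"]) auto
  then show False using assms by (auto simp: const_poly_dvd_iff)
qed

lemma congruent_nonroot_exists:
  fixes g :: "int poly" and M y :: int
  assumes "g \<noteq> 0" "M \<noteq> 0"
  shows "\<exists>z. [z = y] (mod M) \<and> poly g z \<noteq> 0"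
proof (rule ccontr)
  assume *: "\<not> ?thesis"
  have "poly g (y + int t * M) = 0" for t
  proof -
    have "[y + int t * M = y] (mod M)" by (simp add: cong_iff_dvd_diff)
    then show ?thesis using * by blast
  qed
  then have "range (\<lambda>t. y + int t * M) \<subseteq> {x. poly g x = 0}" by blast
  moreover have "inj (\<lambda>t. y + int t * M)" using assms(2) by (auto intro!: injI)
  ultimately show False
    using poly_roots_finite[OF assms(1)] by (meson finite_imageD finite_subset infinite_UNIV_nat)
qed

text \<open>
  Induction on the number of variables.  The coefficients with respect to the last variable
  are again coprime, so the first coordinates can be chosen such that for no prime \<open>p\<close> outside
  \<open>N\<close> all polynomials vanish identically modulo \<open>p\<close> as polynomials in the last variable.  Then
  only the finitely many primes dividing the value of the eliminant \<open>e\<close> restrict the choice of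
  the last coordinate.  The polynomial \<open>A\<close> serves to keep the eliminant nonzero.
\<close>

lemma coprime_values_away_from_modulus:
  fixes F :: "int mpoly set"
  assumes "finite F" "F \<subseteq> mpolys r" "\<exists>f\<in>F. f \<noteq> 0"
    and "\<And>D. D \<in> mpolys r \<Longrightarrow> (\<And>f. f \<in> F \<Longrightarrow> dvd_in (mpolys r) D f) \<Longrightarrow> D \<in> mpolys 0"
    and "A \<in> mpolys r" "A \<noteq> 0"
  shows "\<exists>B>0. \<forall>N a. N > 0 \<longrightarrow> B dvd N \<longrightarrow> (\<exists>m. (\<forall>i<r. [m i = a i] (mod N)) \<and>
    mpoly_eval A m \<noteq> 0 \<and> (\<forall>p. prime p \<longrightarrow> (\<forall>f\<in>F. p dvd mpoly_eval f m) \<longrightarrow> p dvd N))"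
  using assms
proof (induction r arbitrary: F A)
  case 0
  obtain f where f: "f \<in> F" "f \<noteq> 0" using 0 by blast
  have const: "\<exists>c. g = Poly_Mapping.single 0 c" if "g \<in> mpolys 0" for g :: "int mpoly"
    using that unfolding mpolys_0 by blast
  obtain c where c: "f = Poly_Mapping.single 0 c" using const f 0 by blast
  obtain a where a: "A = Poly_Mapping.single 0 a" using const 0 by blast
  have eval: "mpoly_eval (Poly_Mapping.single 0 b) n = b" for b :: int and n
    by (simp add: mpoly_eval_single monomial_eval_def)
  have "c \<noteq> 0" "a \<noteq> 0" using f c a 0 by auto
  \<comment> \<open>Without variables all values are constants, and the bound
    \<open>\<bar>c\<bar>\<close> for one nonzero \<open>c\<close> forces every common prime divisor
    into \<open>N\<close>.\<close>
  moreover have "p dvd N" if "\<bar>c\<bar> dvd N" "\<forall>f\<in>F. p dvd mpoly_eval f n" for p N n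
  proof -
    have "p dvd c" using that(2) f(1) c eval by metis
    then show ?thesis using that(1) by (meson abs_dvd_iff dvd_trans)
  qed
  ultimately show ?case using a eval by (intro exI[of _ "\<bar>c\<bar>"]) auto
next
  case (Suc r)
  define \<phi> where "\<phi> p = poly p (mpoly_var r)" for p :: "int mpoly poly"
  define S where "S = (mpolys r :: int mpoly set)"
  interpret ufd_subring S unfolding S_def by (rule ufd_subring_mpolys)
  have \<phi>_const: "\<phi> [:c:] = c" for c by (simp add: \<phi>_def)
  have dvd_\<phi>: "dvd_in (mpolys (Suc r)) (\<phi> p) (\<phi> q) \<longleftrightarrow> dvd_in T p q" if "p \<in> T" "q \<in> T" for p q
    using dvd_in_poly_var_iff that by (simp add: \<phi>_def S_def)
  have \<phi>_inj: "p = q" if "p \<in> T" "q \<in> T" "\<phi> p = \<phi> q" for p q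
    using poly_var_eq_0[of "p - q" r] that poly_diff_closed by (simp add: \<phi>_def S_def)
  have \<phi>_closed: "\<phi> p \<in> mpolys (Suc r)" if "p \<in> T" for p
    using poly_var_closed that by (simp add: \<phi>_def S_def)
  have range_\<phi>: "mpolys (Suc r) = \<phi> ` T" by (simp add: mpolys_Suc \<phi>_def[abs_def] S_def)
  obtain G where G: "finite G" "G \<subseteq> T" "F = \<phi> ` G"
    using finite_subset_image[OF Suc.prems(1), of \<phi> T] Suc.prems(2) range_\<phi> by auto
  obtain h where h: "h \<in> T" "A = \<phi> h" using Suc.prems(5) range_\<phi> by blast
  have h0: "h \<noteq> 0" using Suc.prems(6) h by (auto simp: \<phi>_def)
  obtain g0 where g0: "g0 \<in> G" "g0 \<noteq> 0"
  proof -
    obtain g where "g \<in> G" "\<phi> g \<noteq> 0" using Suc.prems(3) G(3) by blast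
    moreover have "\<phi> 0 = 0" by (simp add: \<phi>_def)
    ultimately show thesis using that by metis
  qed

  have "\<exists>e\<in>S. \<exists>u. e \<noteq> 0 \<and> (\<forall>g\<in>G. u g \<in> T) \<and> [:e:] = (\<Sum>g\<in>G. u g * g)"
  proof (rule elimination[OF G(1,2)])
    fix d assume d: "d \<in> T" "\<And>g. g \<in> G \<Longrightarrow> dvd_in T d g"
    have "\<phi> d \<in> mpolys 0"
    proof (rule Suc.prems(4))
      show "dvd_in (mpolys (Suc r)) (\<phi> d) f" if "f \<in> F" for f
        using that d dvd_\<phi> G(2,3) by blast
    qed (rule \<phi>_closed[OF d(1)])
    then have "[:\<phi> d:] \<in> T" using mpolys_mono[of "\<phi> d" 0 r] const_closed by (simp add: S_def)
    then have "d = [:\<phi> d:]" using \<phi>_inj[OF d(1)] \<phi>_const by simp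
    then show "degree d = 0" by (metis degree_pCons_0)
  qed (use g0 in blast)
  then obtain e u where e: "e \<in> S" "e \<noteq> 0" and u: "\<And>g. g \<in> G \<Longrightarrow> u g \<in> T"
    and eu: "[:e:] = (\<Sum>g\<in>G. u g * g)" by blast

  \<comment> \<open>A common divisor of these coefficients, read as a constant polynomial in the
    last variable, divides all of \<open>F\<close>; so \<open>C\<close> inherits the hypothesis on
    common divisors.\<close>
  define C where "C = (\<Union>g\<in>G. coeff g ` {..degree g})"
  have C_S: "C \<subseteq> S" using G(2) coeff_closed by (auto simp: C_def)
  \<comment> \<open>Two things must survive the choice of the first coordinates: the eliminant
    \<open>e\<close>, so that only finitely many primes remain, and \<open>lead_coeff h\<close>, so
    that \<open>A\<close> does not become the zero polynomial in the last variable.\<close>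
  have "\<exists>B>0. \<forall>N a. N > 0 \<longrightarrow> B dvd N \<longrightarrow> (\<exists>m. (\<forall>i<r. [m i = a i] (mod N)) \<and>
    mpoly_eval (e * lead_coeff h) m \<noteq> 0 \<and> (\<forall>p. prime p \<longrightarrow> (\<forall>c\<in>C. p dvd mpoly_eval c m) \<longrightarrow> p dvd N))"
  proof (rule Suc.IH)
    show "finite C" using G(1) by (simp add: C_def)
    show "C \<subseteq> mpolys r" using C_S by (simp add: S_def)
    show C0: "\<exists>c\<in>C. c \<noteq> 0" using g0 by (auto simp: C_def intro!: bexI[of _ g0] bexI[of _ "degree g0"])
    show "e * lead_coeff h \<in> mpolys r" using mult_closed[OF e(1) coeff_closed[OF h(1)]] by (simp add: S_def)
    show "e * lead_coeff h \<noteq> 0" using e h0 by simp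
    fix D assume "D \<in> mpolys r" and dvd: "\<And>c. c \<in> C \<Longrightarrow> dvd_in (mpolys r) D c"
    then have D: "D \<in> S" by (simp add: S_def)
    have D0: "D \<noteq> 0" using C0 dvd by (auto simp: dvd_in_def)
    have "dvd_in T [:D:] g" if g: "g \<in> G" for g
    proof -
      have "dvd_in S D (coeff g k)" for k
      proof (cases "k \<le> degree g")
        case True
        then show ?thesis using dvd[of "coeff g k"] g by (auto simp: C_def S_def)
      next
        case False
        then show ?thesis using dvd_in_zero by (simp add: coeff_eq_0)
      qed
      then show ?thesis using dvd_in_const_iff[OF D D0] G(2) g by blast
    qed
    then have "dvd_in (mpolys (Suc r)) D f" if "f \<in> F" for f
      using that G(2,3) dvd_\<phi>[OF const_closed[OF D]] \<phi>_const by auto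
    moreover have "D \<in> mpolys (Suc r)" using \<open>D \<in> mpolys r\<close> mpolys_mono by fastforce
    ultimately show "D \<in> mpolys 0" using Suc.prems(4) by blast
  qed
  then obtain B where B: "B > 0" and IH: "\<And>N a. N > 0 \<Longrightarrow> B dvd N \<Longrightarrow> \<exists>m. (\<forall>i<r. [m i = a i] (mod N)) \<and>
    mpoly_eval (e * lead_coeff h) m \<noteq> 0 \<and> (\<forall>p. prime p \<longrightarrow> (\<forall>c\<in>C. p dvd mpoly_eval c m) \<longrightarrow> p dvd N)"
    by blast

  \<comment> \<open>\<open>d\<close> bounds all degrees in the last variable. The factor
    \<open>fact d\<close> of the new bound puts every prime up to \<open>d\<close> into
    \<open>N\<close>, so every prime outside \<open>N\<close> exceeds the degrees and a nonroot
    modulo it exists.\<close>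
  define d where "d = (\<Sum>g\<in>G. degree g)"
  have deg: "degree g \<le> d" if "g \<in> G" for g
    unfolding d_def using that G(1) by (intro member_le_sum) auto
  have "\<exists>m. (\<forall>i<Suc r. [m i = a i] (mod N)) \<and> mpoly_eval A m \<noteq> 0 \<and>
      (\<forall>p. prime p \<longrightarrow> (\<forall>f\<in>F. p dvd mpoly_eval f m) \<longrightarrow> p dvd N)"
    if N: "N > 0" "B * fact d dvd N" for N :: int and a
  proof -
    have "B dvd N" using N(2) by (rule dvd_mult_left)
    from IH[OF N(1) this, of a] obtain m where m: "\<And>i. i < r \<Longrightarrow> [m i = a i] (mod N)"
      and A_m: "mpoly_eval (e * lead_coeff h) m \<noteq> 0"
      and C_m: "\<And>p. prime p \<Longrightarrow> (\<And>c. c \<in> C \<Longrightarrow> p dvd mpoly_eval c m) \<Longrightarrow> p dvd N"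
      by blast
    define ev where "ev c = mpoly_eval c m" for c
    have ev_e: "ev e \<noteq> 0" and ev_h: "ev (lead_coeff h) \<noteq> 0"
      using A_m by (auto simp: ev_def mpoly_eval_mult)
    have ev0: "ev 0 = 0" by (simp add: ev_def mpoly_eval_zero)
    have large: "int d < p" if p: "prime p" "\<not> p dvd N" for p
    proof (rule ccontr)
      assume "\<not> ?thesis"
      moreover obtain q where q: "p = int q" using p(1) prime_ge_0_int zero_le_imp_eq_int by blast
      ultimately have "q dvd fact d" using p(1) prime_dvd_fact_iff[of q d] by simp
      then have "p dvd fact d" unfolding q by (metis of_nat_dvd_iff of_nat_fact)
      then show False using p N(2) dvd_trans dvd_mult_right by blast
    qed
    \<comment> \<open>By the elimination identity, a prime that divides all values divides
      \<open>ev e\<close>. Hence the primes outside \<open>N\<close> that need attention are those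
      in \<open>Q\<close>.\<close>
    define Q where "Q = {p. prime p \<and> p dvd ev e \<and> \<not> p dvd N}"
    have Q: "finite Q" using finite_divisors_int[OF ev_e] by (rule finite_subset[rotated]) (auto simp: Q_def)
    have "\<exists>y. \<exists>g\<in>G. \<not> p dvd poly (map_poly ev g) y" if p: "p \<in> Q" for p
    proof -
      have p': "prime p" "\<not> p dvd N" using p by (auto simp: Q_def)
      then obtain c where "c \<in> C" "\<not> p dvd ev c" using C_m by (auto simp: ev_def)
      then obtain g k where g: "g \<in> G" "\<not> p dvd ev (coeff g k)" by (auto simp: C_def)
      have "degree (map_poly ev g) \<le> degree g"
        using ev0 by (intro degree_le) (simp add: coeff_map_poly coeff_eq_0)
      then have "int (degree (map_poly ev g)) < p"
        using large[OF p'] deg[OF g(1)] by linarith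
      then show ?thesis
        using nonroot_mod_prime_exists[OF p'(1), of "map_poly ev g" k] g ev0
        by (auto simp: coeff_map_poly)
    qed
    then obtain Y where Y: "\<And>p. p \<in> Q \<Longrightarrow> \<exists>g\<in>G. \<not> p dvd poly (map_poly ev g) (Y p)" by metis
    obtain y1 where y1: "\<forall>p\<in>Q. [y1 = Y p] (mod p)"
      using chinese_remainder_int[OF Q, of "\<lambda>p. p" Y] primes_coprime by (auto simp: Q_def)
    have "coprime N (\<Prod>Q)"
      by (intro prod_coprime_right) (auto simp: Q_def coprime_commute prime_imp_coprime)
    then obtain y2 where y2: "[y2 = a r] (mod N)" "[y2 = y1] (mod \<Prod>Q)"
      using binary_chinese_remainder_int by blast
    \<comment> \<open>Shifting \<open>y2\<close> by multiples of \<open>N * \<Prod>Q\<close>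
      preserves both congruences and leaves infinitely many candidates, so the roots of
      \<open>map_poly ev h\<close> can be avoided.\<close>
    have "N * \<Prod>Q \<noteq> 0" using N(1) Q by (auto simp: Q_def)
    moreover have "map_poly ev h \<noteq> 0"
      using ev_h ev0 by (metis coeff_0 coeff_map_poly)
    ultimately obtain y where y: "[y = y2] (mod N * \<Prod>Q)" "poly (map_poly ev h) y \<noteq> 0"
      using congruent_nonroot_exists by blast
    have yN: "[y = a r] (mod N)"
      using y(1) y2(1) cong_modulus_mult cong_trans by blast
    have yQ: "[y = Y p] (mod p)" if "p \<in> Q" for p
    proof -
      have "p dvd \<Prod>Q" using that Q dvd_prodI[of Q p "\<lambda>p. p"] by simp
      moreover have "[y = y1] (mod \<Prod>Q)"
        using y(1) y2(2) cong_trans by (metis cong_modulus_mult mult.commute)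
      ultimately show ?thesis using y1 that cong_dvd_modulus cong_trans by blast
    qed
    have ev_upd: "mpoly_eval c (m(r := y)) = ev c" if "c \<in> S" for c
      unfolding ev_def by (rule mpoly_eval_cong[of _ r]) (use that in \<open>auto simp: S_def\<close>)
    have eval_\<phi>: "mpoly_eval (\<phi> p) (m(r := y)) = poly (map_poly ev p) y" if "p \<in> T" for p
    proof -
      have "map_poly (\<lambda>c. mpoly_eval c (m(r := y))) p = map_poly ev p"
        using ev_upd[OF coeff_closed[OF that]] ev0
        by (intro poly_eqI) (simp add: coeff_map_poly mpoly_eval_zero)
      then show ?thesis by (simp add: \<phi>_def mpoly_eval_poly_var)
    qed
    have "p dvd N" if p: "prime p" "\<forall>f\<in>F. p dvd mpoly_eval f (m(r := y))" for p
    proof (rule ccontr)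
      assume pN: "\<not> p dvd N"
      have "e = (\<Sum>g\<in>G. \<phi> (u g) * \<phi> g)"
        using arg_cong[OF eu, of \<phi>] \<phi>_const by (simp add: \<phi>_def poly_sum)
      then have "ev e = (\<Sum>g\<in>G. mpoly_eval (\<phi> (u g)) (m(r := y)) * mpoly_eval (\<phi> g) (m(r := y)))"
        using ev_upd[OF e(1)] by (simp add: mpoly_eval_sum mpoly_eval_mult)
      then have "p dvd ev e" using p(2) G(3) by (auto intro!: dvd_sum)
      then have pQ: "p \<in> Q" using p(1) pN by (simp add: Q_def)
      then obtain g where g: "g \<in> G" "\<not> p dvd poly (map_poly ev g) (Y p)" using Y by blast
      then have "\<not> p dvd poly (map_poly ev g) y"
        using cong_poly[OF yQ[OF pQ]] cong_dvd_iff by blast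
      moreover have "g \<in> T" "p dvd mpoly_eval (\<phi> g) (m(r := y))" using p(2) g(1) G(2,3) by auto
      ultimately show False using eval_\<phi> by simp
    qed
    moreover have "mpoly_eval A (m(r := y)) \<noteq> 0" using eval_\<phi>[OF h(1)] h(2) y(2) by simp
    moreover have "\<forall>i<Suc r. [(m(r := y)) i = a i] (mod N)"
      using m yN by (auto simp: less_Suc_eq)
    ultimately show ?thesis by blast
  qed
  then show ?case using B by (intro exI[of _ "B * fact d"]) auto
qed

section \<open>Points with prescribed multiplicities of the gcd value\<close>

lemma mpoly_eval_cong_mod:
  fixes p :: "int mpoly"
  assumes "p \<in> mpolys r" "\<And>i. i < r \<Longrightarrow> [n i = n' i] (mod N)"
  shows "[mpoly_eval p n = mpoly_eval p n'] (mod N)"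
  unfolding mpoly_eval_def using assms
  by (intro cong_sum cong_mult cong_prod cong_pow) (auto dest!: mpolysD)

lemma gcd_value_selecting_exists:
  fixes P :: "nat \<Rightarrow> int mpoly" and \<sigma> :: "int \<Rightarrow> bool"
  assumes "s > 0" and P: "\<And>i. i < s \<Longrightarrow> P i \<in> mpolys r" "\<And>i. i < s \<Longrightarrow> P i \<noteq> 0"
    and coprime: "coprime_mpolys r s P"
    and d: "d = gcd_value s P n" "d' = gcd_value s P n'" "d \<noteq> 0" "d' \<noteq> 0"
  shows "\<exists>D\<in>gcd_values r s P. D \<noteq> 0 \<and>
    (\<forall>p. prime p \<longrightarrow> multiplicity p D = multiplicity p (if \<sigma> p then d else d'))"
proof -
  \<comment> \<open>\<open>P 0\<close> is the polynomial kept nonzero, which makes the gcd value at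
    the new point nonzero.\<close>
  have "\<exists>B>0. \<forall>N a. N > 0 \<longrightarrow> B dvd N \<longrightarrow> (\<exists>m. (\<forall>i<r. [m i = a i] (mod N)) \<and>
    mpoly_eval (P 0) m \<noteq> 0 \<and> (\<forall>p. prime p \<longrightarrow> (\<forall>f\<in>P ` {..<s}. p dvd mpoly_eval f m) \<longrightarrow> p dvd N))"
    using assms coprime_mpolys_common_divisor[OF coprime]
    by (intro coprime_values_away_from_modulus) auto
  then obtain B :: int where B: "B > 0" and sieve: "\<And>N a. N > 0 \<Longrightarrow> B dvd N \<Longrightarrow>
      \<exists>m. (\<forall>i<r. [m i = a i] (mod N)) \<and> mpoly_eval (P 0) m \<noteq> 0 \<and>
        (\<forall>p. prime p \<longrightarrow> (\<forall>f\<in>P ` {..<s}. p dvd mpoly_eval f m) \<longrightarrow> p dvd N)" by blast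
  \<comment> \<open>The factor \<open>B\<close> makes the sieve applicable, and \<open>d\<close> and
    \<open>d'\<close> bring in every prime at which a positive multiplicity is to be
    realized.\<close>
  define M where "M = \<bar>B * d * d'\<bar>"
  \<comment> \<open>The precision modulo \<open>M\<^sup>2\<close>. To fix a multiplicity, the
    congruence must also decide the next higher power of \<open>p\<close>; for \<open>p\<close>
    dividing \<open>M\<close>, doubling leaves room for it.\<close>
  define v where "v p = 2 * multiplicity p M" for p
  have M: "M > 0" using B d by (simp add: M_def)
  have BM: "B dvd M\<^sup>2" by (simp add: M_def power2_eq_square)
  define t where "t p = (if \<sigma> p then n else n')" for p
  have gcd_t: "gcd_value s P (t p) = (if \<sigma> p then d else d')" for p by (simp add: t_def d)
  have coprime_powers: "coprime (p ^ v p) (q ^ v q)"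
    if "p \<in> prime_factors M" "q \<in> prime_factors M" "p \<noteq> q" for p q
    using primes_coprime[of p q] that by (auto simp: in_prime_factors_iff)
  have "\<exists>x. \<forall>p\<in>prime_factors M. [x = t p i] (mod p ^ v p)" for i
    using chinese_remainder_int[of "prime_factors M" "\<lambda>p. p ^ v p" "\<lambda>p. t p i"] coprime_powers by blast
  then obtain a where a: "\<And>i p. p \<in> prime_factors M \<Longrightarrow> [a i = t p i] (mod p ^ v p)" by metis
  obtain m where m: "\<And>i. i < r \<Longrightarrow> [m i = a i] (mod M\<^sup>2)" "mpoly_eval (P 0) m \<noteq> 0"
    "\<And>p. prime p \<Longrightarrow> (\<And>f. f \<in> P ` {..<s} \<Longrightarrow> p dvd mpoly_eval f m) \<Longrightarrow> p dvd M\<^sup>2"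
    using sieve[of "M\<^sup>2" a] BM M by (metis zero_less_power)
  define D where "D = gcd_value s P m"
  have dvd_gcd_value: "k dvd gcd_value s P x \<longleftrightarrow> (\<forall>i<s. k dvd mpoly_eval (P i) x)" for k x
    by (auto simp: gcd_value_def dvd_Gcd_iff)
  have "D = gcd_value s P (restrict m {..<r})"
    unfolding D_def gcd_value_def using P(1)
    by (intro arg_cong[of _ _ Gcd] image_cong mpoly_eval_cong[of _ r]) auto
  moreover have "restrict m {..<r} \<in> {..<r} \<rightarrow>\<^sub>E UNIV" by simp
  ultimately have "D \<in> gcd_values r s P" unfolding gcd_values_def by blast
  moreover have "D \<noteq> 0"
    using dvd_gcd_value[of D m] m(2) \<open>s > 0\<close> by (auto simp: D_def)
  moreover have "multiplicity p D = multiplicity p (if \<sigma> p then d else d')" if p: "prime p" for p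
  proof -
    define c where "c = (if \<sigma> p then d else d')"
    have c: "c \<noteq> 0" "c dvd M" using d by (auto simp: c_def M_def)
    show ?thesis
    proof (cases "p dvd M")
      case True
      then have pM: "p \<in> prime_factors M" using p M by (simp add: in_prime_factors_iff)
      have "p ^ v p dvd M\<^sup>2"
        unfolding v_def by (metis multiplicity_dvd dvd_power_same mult.commute power_mult)
      then have "[m i = t p i] (mod p ^ v p)" if "i < r" for i
        using m(1)[OF that] a[OF pM, of i] cong_dvd_modulus cong_trans by blast
      then have "[mpoly_eval (P i) m = mpoly_eval (P i) (t p)] (mod p ^ v p)" if "i < s" for i
        using mpoly_eval_cong_mod[OF P(1)[OF that]] by blast
      then have "p ^ k dvd mpoly_eval (P i) m \<longleftrightarrow> p ^ k dvd mpoly_eval (P i) (t p)"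
        if "i < s" "k \<le> v p" for i k
        using that cong_dvd_iff cong_dvd_modulus le_imp_power_dvd by blast
      then have dvd_iff: "p ^ k dvd D \<longleftrightarrow> p ^ k dvd c" if "k \<le> v p" for k
        using that dvd_gcd_value[of "p ^ k" m] dvd_gcd_value[of "p ^ k" "t p"] gcd_t[of p]
        by (auto simp: D_def c_def)
      have "0 < multiplicity p M" using True p M prime_multiplicity_gt_zero_iff[OF prime_imp_prime_elem[OF p], of M] by simp
      moreover have "multiplicity p c \<le> multiplicity p M"
        using c M by (intro dvd_imp_multiplicity_le) auto
      ultimately have less: "Suc (multiplicity p c) \<le> v p" by (simp add: v_def)
      have "multiplicity p D = multiplicity p c"
      proof (rule multiplicity_eqI)
        show "p ^ multiplicity p c dvd D" using dvd_iff less multiplicity_dvd by simp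
        have "\<not> p ^ Suc (multiplicity p c) dvd c"
          using c(1) p by (subst power_dvd_iff_le_multiplicity) auto
        then show "\<not> p ^ Suc (multiplicity p c) dvd D" using dvd_iff[OF less] by simp
      qed
      then show ?thesis by (simp add: c_def)
    next
      case False
      then have "\<not> p dvd c" using c dvd_trans by blast
      moreover have "\<not> p dvd D"
        using m(3)[OF p] False p dvd_gcd_value[of p m] prime_dvd_power by (auto simp: D_def)
      ultimately show ?thesis by (simp add: c_def not_dvd_imp_multiplicity_0)
    qed
  qed
  ultimately show ?thesis by blast
qed

theorem theorem1p1:
  fixes r s :: nat and P :: "nat \<Rightarrow> int mpoly"
  assumes "r \<ge> 1" and "s \<ge> 2"
    and "\<And>i. i < s \<Longrightarrow> P i \<in> mpolys r"
    and "\<And>i. i < s \<Longrightarrow> P i \<noteq> 0"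
    and "coprime_mpolys r s P"
  shows "\<forall>d \<in> gcd_values r s P. \<forall>d' \<in> gcd_values r s P.
           gcd d d' \<in> gcd_values r s P \<and> lcm d d' \<in> gcd_values r s P"
proof (intro ballI)
  fix d d' assume mem: "d \<in> gcd_values r s P" "d' \<in> gcd_values r s P"
  have nonneg: "x \<ge> 0" if "x \<in> gcd_values r s P" for x
    using that Gcd_int_greater_eq_0 unfolding gcd_values_def gcd_value_def by blast
  show "gcd d d' \<in> gcd_values r s P \<and> lcm d d' \<in> gcd_values r s P"
  proof (cases "d = 0 \<or> d' = 0")
    \<comment> \<open>Multiplicities carry no information about the value 0, but then the gcd is the
      other value and the lcm is 0.\<close>
    case True
    then show ?thesis using mem nonneg by auto
  next
    case False
    \<comment> \<open>Nonzero nonnegative integers are determined by their multiplicities, and gcd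
      and lcm arise by selecting the smaller or the larger one at each prime.\<close>
    have select: "\<exists>D\<in>gcd_values r s P. D \<noteq> 0 \<and>
        (\<forall>p. prime p \<longrightarrow> multiplicity p D = multiplicity p (if \<sigma> p then d else d'))" for \<sigma>
    proof -
      obtain n n' where "d = gcd_value s P n" "d' = gcd_value s P n'"
        using mem by (auto simp: gcd_values_def)
      then show ?thesis using gcd_value_selecting_exists assms False by simp
    qed
    have "gcd d d' \<in> gcd_values r s P"
    proof -
      obtain D where D: "D \<in> gcd_values r s P" "D \<noteq> 0" and mult: "\<And>p. prime p \<Longrightarrow>
          multiplicity p D = multiplicity p (if multiplicity p d \<le> multiplicity p d' then d else d')"
        using select[of "\<lambda>p. multiplicity p d \<le> multiplicity p d'"] by blast
      have "D dvd d" "D dvd d'" using mult D(2) by (auto intro!: multiplicity_le_imp_dvd)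
      moreover have "gcd d d' dvd D"
      proof (rule multiplicity_le_imp_dvd)
        fix p :: int assume "prime p"
        moreover have "multiplicity p (gcd d d') \<le> multiplicity p d"
          "multiplicity p (gcd d d') \<le> multiplicity p d'"
          using False by (simp_all add: dvd_imp_multiplicity_le)
        ultimately show "multiplicity p (gcd d d') \<le> multiplicity p D" by (simp add: mult)
      qed (use False in simp)
      ultimately have "gcd d d' = D"
        using nonneg[OF D(1)] by (intro zdvd_antisym_nonneg) auto
      then show ?thesis using D by simp
    qed
    moreover have "lcm d d' \<in> gcd_values r s P"
    proof -
      obtain D where D: "D \<in> gcd_values r s P" "D \<noteq> 0" and mult: "\<And>p. prime p \<Longrightarrow>
          multiplicity p D = multiplicity p (if multiplicity p d \<ge> multiplicity p d' then d else d')"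
        using select[of "\<lambda>p. multiplicity p d \<ge> multiplicity p d'"] by blast
      have "d dvd D" "d' dvd D" using mult False by (auto intro!: multiplicity_le_imp_dvd)
      moreover have "D dvd lcm d d'"
      proof (rule multiplicity_le_imp_dvd)
        fix p :: int assume "prime p"
        moreover have "multiplicity p d \<le> multiplicity p (lcm d d')"
          "multiplicity p d' \<le> multiplicity p (lcm d d')"
          using False by (simp_all add: dvd_imp_multiplicity_le)
        ultimately show "multiplicity p D \<le> multiplicity p (lcm d d')" by (simp add: mult)
      qed (rule D(2))
      ultimately have "lcm d d' = D"
        using nonneg[OF D(1)] by (intro zdvd_antisym_nonneg) auto
      then show ?thesis using D by simp
    qed
    ultimately show ?thesis by blast
  qed
qed

end
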